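(* Let $X,Y$ be symplectic manifolds and let $M=(M,\omega_M,p_0,p_1)$ be a connected symplectic manifold with two marked points. Assume that there exists $I\in SCor(M,X)$. Then the $M$-homotopy relation is an equivalence relation on $SC(Y,X)$.
   Context: All manifolds are smooth without boundary; products carry the product symplectic form. A symplectic embedding $f:Y\to X$ is an embedding with $f^*\omega_X=\omega_Y$. Symplectic correspondences: for $n\ge0$, $SCor_n(Y,X)$ is the set of global sections over $Y$ of the sheafification of the presheaf sending an open $U\subset Y$ to the set of unordered $n$-tuples $\{f_1,\dots,f_n\}$ of smooth maps $U\to X$ with $\sum_i f_i^*\omega_X=\omega_Y|_U$, two tuples being identified if $\{f_i(y)\}_i=\{g_i(y)\}_i$ as unordered tuples with multiplicity for every $y\in U$. $SCor^0_n(Y,X)$ (isotropic correspondences) is defined likewise with $\sum_i f_i^*\omega_X=0$. $F+G$ denotes local concatenation. On $\coprod_{n\ge0}SCor_n(Y,X)$ let $\sim$ be the equivalence relation generated by $F\sim F+G$ with $G$ isotropic; $SCor(Y,X)$ is the set of global sections over $Y$ of the sheafification of $U\mapsto(\coprod_n SCor_n(U,X))/\!\sim$. $SC(Y,X)=\mathbb{Z}[SCor(Y,X)]$ is the free abelian group (zero if $SCor(Y,X)=\emptyset$). For $H\in SCor(Y',X)$ and a symplectic embedding $h:Y\to Y'$, $H\circ h\in SCor(Y,X)$ is locally given by $\{f_i\circ h\}$ where $H$ is locally $\{f_i\}$; extended linearly to $SC$. $M$-homotopy: $F,G\in SC(Y,X)$ are $M$-homotopic if there is $H\in SC(Y\times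 M,X)$ with $H\circ i_0=F$ and $H\circ i_1=G$, where $i_\varepsilon:Y=Y\times p_\varepsilon\hookrightarrow Y\times M$. *)

theory Defs
  imports "HOL-Analysis.Analysis" "HOL-Algebra.Free_Abelian_Groups"
begin

section \<open>Smooth maps between finite-dimensional vector spaces\<close>

text \<open>
  The model spaces are types of class \<^class>\<open>real_normed_vector\<close> that are assumed to be
  finite-dimensional. The class \<^class>\<open>euclidean_space\<close> is not used because it excludes
  dimension 0, and points are symplectic manifolds.
  In finite dimension continuity of all directional derivatives amounts to \<open>C\<^sup>1\<close>, so the
  following recursion is \<open>C\<^sup>k\<close> on an open set \<open>S\<close>.
\<close>

primrec Ck_on :: "nat \<Rightarrow> 'a::real_normed_vector set \<Rightarrow> ('a \<Rightarrow> 'b::real_normed_vector) \<Rightarrow> bool" where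
  "Ck_on 0 S f \<longleftrightarrow> continuous_on S f"
| "Ck_on (Suc k) S f \<longleftrightarrow>
     (\<forall>x\<in>S. f differentiable (at x)) \<and> (\<forall>v. Ck_on k S (\<lambda>x. frechet_derivative f (at x) v))"

definition smooth_on :: "'a::real_normed_vector set \<Rightarrow> ('a \<Rightarrow> 'b::real_normed_vector) \<Rightarrow> bool" where
  "smooth_on S f \<longleftrightarrow> (\<forall>k. Ck_on k S f)"


section \<open>Symplectic manifolds\<close>

text \<open>
  A manifold is a topological space with an indexed (not necessarily maximal) atlas. The chart
  \<open>i\<close> is the map \<open>cmap i\<close>, of which only the restriction to the open set \<open>cdom i\<close> matters.
  A differential 2-form is given by its coordinate expressions: \<open>cform i x v w\<close> is the value on
  the coordinate vectors \<open>v, w\<close> at the point with coordinates \<open>x\<close> in the chart \<open>i\<close>.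
\<close>

record ('i, 'a, 'e) mfd =
  mtop :: "'a topology"
  cidx :: "'i set"
  cdom :: "'i \<Rightarrow> 'a set"
  cmap :: "'i \<Rightarrow> 'a \<Rightarrow> 'e"
  cform :: "'i \<Rightarrow> 'e \<Rightarrow> 'e \<Rightarrow> 'e \<Rightarrow> real"

definition cinv :: "('i, 'a, 'e) mfd \<Rightarrow> 'i \<Rightarrow> 'e \<Rightarrow> 'a" where
  "cinv M i = inv_into (cdom M i) (cmap M i)"

definition smooth_manifold :: "('i, 'a, 'e::real_normed_vector) mfd \<Rightarrow> bool" where
  "smooth_manifold M \<longleftrightarrow>
     (\<exists>B::'e set. finite B \<and> span B = UNIV) \<and>
     Hausdorff_space (mtop M) \<and> second_countable (mtop M) \<and>
     (\<Union>i\<in>cidx M. cdom M i) = topspace (mtop M) \<and>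
     (\<forall>i\<in>cidx M. openin (mtop M) (cdom M i) \<and> open (cmap M i ` cdom M i) \<and>
        homeomorphic_map (subtopology (mtop M) (cdom M i))
          (top_of_set (cmap M i ` cdom M i)) (cmap M i)) \<and>
     (\<forall>i\<in>cidx M. \<forall>j\<in>cidx M.
        smooth_on (cmap M i ` (cdom M i \<inter> cdom M j)) (cmap M j \<circ> cinv M i))"

definition two_form :: "('i, 'a, 'e::real_normed_vector) mfd \<Rightarrow> bool" where
  "two_form M \<longleftrightarrow>
     (\<forall>i\<in>cidx M.
        (\<forall>x\<in>cmap M i ` cdom M i. bilinear (cform M i x) \<and> (\<forall>v. cform M i x v v = 0)) \<and>
        (\<forall>v w. smooth_on (cmap M i ` cdom M i) (\<lambda>x. cform M i x v w))) \<and>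
     (\<forall>i\<in>cidx M. \<forall>j\<in>cidx M. \<forall>p\<in>cdom M i \<inter> cdom M j. \<forall>v w.
        let D = frechet_derivative (cmap M j \<circ> cinv M i) (at (cmap M i p)) in
        cform M i (cmap M i p) v w = cform M j (cmap M j p) (D v) (D w))"

text \<open>
  Closedness is \<open>d\<omega> = 0\<close> evaluated on constant coordinate vector fields \<open>u, v, w\<close>, for which
  \<open>d\<omega>(u,v,w) = u(\<omega>(v,w)) + v(\<omega>(w,u)) + w(\<omega>(u,v))\<close>.
\<close>

definition closed_form :: "('i, 'a, 'e::real_normed_vector) mfd \<Rightarrow> bool" where
  "closed_form M \<longleftrightarrow>
     (\<forall>i\<in>cidx M. \<forall>x\<in>cmap M i ` cdom M i. \<forall>u v w.
        frechet_derivative (\<lambda>z. cform M i z v w) (at x) u +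
        frechet_derivative (\<lambda>z. cform M i z w u) (at x) v +
        frechet_derivative (\<lambda>z. cform M i z u v) (at x) w = 0)"

definition nondegenerate_form :: "('i, 'a, 'e::real_normed_vector) mfd \<Rightarrow> bool" where
  "nondegenerate_form M \<longleftrightarrow>
     (\<forall>i\<in>cidx M. \<forall>x\<in>cmap M i ` cdom M i. \<forall>v. v \<noteq> 0 \<longrightarrow> (\<exists>w. cform M i x v w \<noteq> 0))"

definition symplectic_manifold :: "('i, 'a, 'e::real_normed_vector) mfd \<Rightarrow> bool" where
  "symplectic_manifold M \<longleftrightarrow>
     smooth_manifold M \<and> two_form M \<and> closed_form M \<and> nondegenerate_form M"

definition prod_mfd ::
  "('i, 'a, 'e) mfd \<Rightarrow> ('j, 'b, 'f) mfd \<Rightarrow> ('i \<times> 'j, 'a \<times> 'b, 'e \<times> 'f) mfd" where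
  "prod_mfd Y M =
     \<lparr>mtop = prod_topology (mtop Y) (mtop M),
      cidx = cidx Y \<times> cidx M,
      cdom = (\<lambda>(i, j). cdom Y i \<times> cdom M j),
      cmap = (\<lambda>(i, j) (y, m). (cmap Y i y, cmap M j m)),
      cform = (\<lambda>(i, j) (x, z) (v, v') (w, w'). cform Y i x v w + cform M j z v' w')\<rparr>"

text \<open>Smooth maps on an open subset \<open>U\<close> of \<open>Y\<close>; the values of \<open>f\<close> outside \<open>U\<close> are irrelevant.\<close>

definition local_rep ::
  "('i, 'a, 'e) mfd \<Rightarrow> ('j, 'x, 'f) mfd \<Rightarrow> ('a \<Rightarrow> 'x) \<Rightarrow> 'i \<Rightarrow> 'j \<Rightarrow> 'e \<Rightarrow> 'f" where
  "local_rep Y X f i j = cmap X j \<circ> f \<circ> cinv Y i"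

definition smooth_map_on ::
  "('i, 'a, 'e::real_normed_vector) mfd \<Rightarrow> ('j, 'x, 'f::real_normed_vector) mfd \<Rightarrow>
   'a set \<Rightarrow> ('a \<Rightarrow> 'x) \<Rightarrow> bool" where
  "smooth_map_on Y X U f \<longleftrightarrow>
     continuous_map (subtopology (mtop Y) U) (mtop X) f \<and>
     (\<forall>i\<in>cidx Y. \<forall>j\<in>cidx X.
        smooth_on (cmap Y i ` {y \<in> U \<inter> cdom Y i. f y \<in> cdom X j}) (local_rep Y X f i j))"

text \<open>
  The pullback \<open>f\<^sup>*\<omega>\<^sub>X\<close> at \<open>y\<close>, evaluated on coordinate vectors \<open>v, w\<close> in the chart \<open>i\<close> of \<open>Y\<close>.
  It does not depend on the chosen chart \<open>j\<close> of \<open>X\<close> around \<open>f y\<close>.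
\<close>

definition pullback_form ::
  "('i, 'a, 'e::real_normed_vector) mfd \<Rightarrow> ('j, 'x, 'f::real_normed_vector) mfd \<Rightarrow>
   ('a \<Rightarrow> 'x) \<Rightarrow> 'i \<Rightarrow> 'a \<Rightarrow> 'e \<Rightarrow> 'e \<Rightarrow> real" where
  "pullback_form Y X f i y v w =
     (let j = (SOME j. j \<in> cidx X \<and> f y \<in> cdom X j);
          D = frechet_derivative (local_rep Y X f i j) (at (cmap Y i y))
      in cform X j (cmap X j (f y)) (D v) (D w))"


section \<open>Sheafification\<close>

text \<open>
  A presheaf of sets on \<open>T\<close> is given by its sets of sections \<open>P U\<close> and its restrictions \<open>res V\<close>
  to smaller open sets \<open>V\<close>. The germ at \<open>y\<close> of a section \<open>F\<close> over \<open>U\<close> is the class of all pairs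
  \<open>(V, G)\<close> that agree with \<open>(U, F)\<close> near \<open>y\<close>. Sections of the sheafification are the functions
  into germs that are locally induced by sections of the presheaf.
\<close>

definition germ ::
  "'a topology \<Rightarrow> ('a set \<Rightarrow> 's set) \<Rightarrow> ('a set \<Rightarrow> 's \<Rightarrow> 's) \<Rightarrow> 'a \<Rightarrow> 'a set \<Rightarrow> 's \<Rightarrow> ('a set \<times> 's) set"
  where
  "germ T P res y U F =
     {(V, G). openin T V \<and> y \<in> V \<and> G \<in> P V \<and>
        (\<exists>W. openin T W \<and> y \<in> W \<and> W \<subseteq> U \<inter> V \<and> res W F = res W G)}"

definition sheafify ::
  "'a topology \<Rightarrow> ('a set \<Rightarrow> 's set) \<Rightarrow> ('a set \<Rightarrow> 's \<Rightarrow> 's) \<Rightarrow> 'a set \<Rightarrow> ('a \<Rightarrow> ('a set \<times> 's) set) set"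
  where
  "sheafify T P res U =
     {s \<in> extensional U. \<forall>y\<in>U. \<exists>V F. openin T V \<and> y \<in> V \<and> V \<subseteq> U \<and> F \<in> P V \<and>
        (\<forall>z\<in>V. s z = germ T P res z V F)}"

definition to_sheaf ::
  "'a topology \<Rightarrow> ('a set \<Rightarrow> 's set) \<Rightarrow> ('a set \<Rightarrow> 's \<Rightarrow> 's) \<Rightarrow> 'a set \<Rightarrow> 's \<Rightarrow> 'a \<Rightarrow> ('a set \<times> 's) set"
  where
  "to_sheaf T P res U F = (\<lambda>z\<in>U. germ T P res z U F)"


section \<open>Symplectic and isotropic correspondences\<close>

text \<open>
  The 2-form \<open>\<eta>\<close> is prescribed by its coordinate expressions in the charts of \<open>Y\<close>, as \<open>cform Y\<close>:
  it is \<open>cform Y\<close> for symplectic and \<open>no_form\<close> for isotropic correspondences.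
\<close>

type_synonym ('i, 'e) coord_form = "'i \<Rightarrow> 'e \<Rightarrow> 'e \<Rightarrow> 'e \<Rightarrow> real"

definition no_form :: "('i, 'e) coord_form" where
  "no_form = (\<lambda>_ _ _ _. 0)"

definition tuples ::
  "('i, 'a, 'e::real_normed_vector) mfd \<Rightarrow> ('j, 'x, 'f::real_normed_vector) mfd \<Rightarrow>
   ('i, 'e) coord_form \<Rightarrow> nat \<Rightarrow> 'a set \<Rightarrow> ('a \<Rightarrow> 'x) list set" where
  "tuples Y X \<eta> n U =
     {fs. length fs = n \<and> (\<forall>f\<in>set fs. smooth_map_on Y X U f) \<and>
        (\<forall>i\<in>cidx Y. \<forall>y\<in>U \<inter> cdom Y i. \<forall>v w.
           (\<Sum>f\<leftarrow>fs. pullback_form Y X f i y v w) = \<eta> i (cmap Y i y) v w)}"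

text \<open>
  Tuples are identified when they have the same multisets of values, so the class of a tuple
  over \<open>U\<close> is represented by its function of values \<open>y \<mapsto> {f\<^sub>1 y, \<dots>, f\<^sub>n y}\<close> on \<open>U\<close>
  (\<open>undefined\<close> outside \<open>U\<close>).
\<close>

definition tuple_class :: "'a set \<Rightarrow> ('a \<Rightarrow> 'x) list \<Rightarrow> 'a \<Rightarrow> 'x multiset" where
  "tuple_class U fs = (\<lambda>y\<in>U. mset (map (\<lambda>f. f y) fs))"

abbreviation res_fun :: "'a set \<Rightarrow> ('a \<Rightarrow> 'b) \<Rightarrow> 'a \<Rightarrow> 'b" where
  "res_fun V F \<equiv> restrict F V"

definition tuple_presheaf ::
  "('i, 'a, 'e::real_normed_vector) mfd \<Rightarrow> ('j, 'x, 'f::real_normed_vector) mfd \<Rightarrow>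
   ('i, 'e) coord_form \<Rightarrow> nat \<Rightarrow> 'a set \<Rightarrow> ('a \<Rightarrow> 'x multiset) set" where
  "tuple_presheaf Y X \<eta> n U = tuple_class U ` tuples Y X \<eta> n U"

type_synonym ('a, 'x) ncor = "'a \<Rightarrow> ('a set \<times> ('a \<Rightarrow> 'x multiset)) set"

text \<open>\<open>Cor_n Y X \<eta> n U\<close> is \<open>SCor\<^sub>n(U, X)\<close>, respectively \<open>SCor\<^sup>0\<^sub>n(U, X)\<close>, for open \<open>U\<close> in \<open>Y\<close>.\<close>

definition Cor_n ::
  "('i, 'a, 'e::real_normed_vector) mfd \<Rightarrow> ('j, 'x, 'f::real_normed_vector) mfd \<Rightarrow>
   ('i, 'e) coord_form \<Rightarrow> nat \<Rightarrow> 'a set \<Rightarrow> ('a, 'x) ncor set" where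
  "Cor_n Y X \<eta> n U = sheafify (mtop Y) (tuple_presheaf Y X \<eta> n) res_fun U"

abbreviation SCor_n where
  "SCor_n Y X n U \<equiv> Cor_n Y X (cform Y) n U"

abbreviation SCor0_n where
  "SCor0_n Y X n U \<equiv> Cor_n Y X no_form n U"

text \<open>\<open>H = F + G\<close> over \<open>U\<close>: concatenation of tuples is pointwise addition of multisets.\<close>

definition is_concat ::
  "('i, 'a, 'e::real_normed_vector) mfd \<Rightarrow> ('j, 'x, 'f::real_normed_vector) mfd \<Rightarrow> 'a set \<Rightarrow>
   nat \<Rightarrow> ('a, 'x) ncor \<Rightarrow> nat \<Rightarrow> ('a, 'x) ncor \<Rightarrow> ('a, 'x) ncor \<Rightarrow> bool" where
  "is_concat Y X U n F m G H \<longleftrightarrow>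
     (\<forall>y\<in>U. \<exists>V fs gs. openin (mtop Y) V \<and> y \<in> V \<and> V \<subseteq> U \<and>
        fs \<in> tuples Y X (cform Y) n V \<and> gs \<in> tuples Y X no_form m V \<and>
        F y = germ (mtop Y) (tuple_presheaf Y X (cform Y) n) res_fun y V (tuple_class V fs) \<and>
        G y = germ (mtop Y) (tuple_presheaf Y X no_form m) res_fun y V (tuple_class V gs) \<and>
        H y = germ (mtop Y) (tuple_presheaf Y X (cform Y) (n + m)) res_fun y V
                (tuple_class V (fs @ gs)))"

definition cor_union ::
  "('i, 'a, 'e::real_normed_vector) mfd \<Rightarrow> ('j, 'x, 'f::real_normed_vector) mfd \<Rightarrow> 'a set \<Rightarrow>
   (nat \<times> ('a, 'x) ncor) set" where
  "cor_union Y X U = (SIGMA n:UNIV. SCor_n Y X n U)"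

inductive cor_step ::
  "('i, 'a, 'e::real_normed_vector) mfd \<Rightarrow> ('j, 'x, 'f::real_normed_vector) mfd \<Rightarrow> 'a set \<Rightarrow>
   nat \<times> ('a, 'x) ncor \<Rightarrow> nat \<times> ('a, 'x) ncor \<Rightarrow> bool" for Y X U where
  "F \<in> SCor_n Y X n U \<Longrightarrow> G \<in> SCor0_n Y X m U \<Longrightarrow> H \<in> SCor_n Y X (n + m) U \<Longrightarrow>
   is_concat Y X U n F m G H \<Longrightarrow> cor_step Y X U (n, F) (n + m, H)"

definition cor_rel ::
  "('i, 'a, 'e::real_normed_vector) mfd \<Rightarrow> ('j, 'x, 'f::real_normed_vector) mfd \<Rightarrow> 'a set \<Rightarrow>
   ((nat \<times> ('a, 'x) ncor) \<times> (nat \<times> ('a, 'x) ncor)) set" where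
  "cor_rel Y X U = {(a, b). equivclp (cor_step Y X U) a b}"

type_synonym ('a, 'x) cor_class = "(nat \<times> ('a, 'x) ncor) set"

definition quot_presheaf ::
  "('i, 'a, 'e::real_normed_vector) mfd \<Rightarrow> ('j, 'x, 'f::real_normed_vector) mfd \<Rightarrow> 'a set \<Rightarrow>
   ('a, 'x) cor_class set" where
  "quot_presheaf Y X U = cor_union Y X U // cor_rel Y X U"

text \<open>The restriction of a class to \<open>V\<close> is the class of the restriction of any representative.\<close>

definition quot_res ::
  "('i, 'a, 'e::real_normed_vector) mfd \<Rightarrow> ('j, 'x, 'f::real_normed_vector) mfd \<Rightarrow> 'a set \<Rightarrow>
   ('a, 'x) cor_class \<Rightarrow> ('a, 'x) cor_class" where
  "quot_res Y X V C = cor_rel Y X V `` ((\<lambda>(n, F). (n, restrict F V)) ` C)"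

type_synonym ('a, 'x) cor = "'a \<Rightarrow> ('a set \<times> ('a, 'x) cor_class) set"

definition SCor ::
  "('i, 'a, 'e::real_normed_vector) mfd \<Rightarrow> ('j, 'x, 'f::real_normed_vector) mfd \<Rightarrow>
   ('a, 'x) cor set" where
  "SCor Y X = sheafify (mtop Y) (quot_presheaf Y X) (quot_res Y X) (topspace (mtop Y))"

abbreviation SC ::
  "('i, 'a, 'e::real_normed_vector) mfd \<Rightarrow> ('j, 'x, 'f::real_normed_vector) mfd \<Rightarrow>
   (('a, 'x) cor \<Rightarrow>\<^sub>0 int) monoid" where
  "SC Y X \<equiv> free_Abelian_group (SCor Y X)"


section \<open>Composition and homotopy\<close>

definition tuple_germ ::
  "('i, 'a, 'e::real_normed_vector) mfd \<Rightarrow> ('j, 'x, 'f::real_normed_vector) mfd \<Rightarrow> 'a \<Rightarrow> 'a set \<Rightarrow>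
   ('a \<Rightarrow> 'x) list \<Rightarrow> ('a set \<times> ('a, 'x) cor_class) set" where
  "tuple_germ Y X y V fs =
     germ (mtop Y) (quot_presheaf Y X) (quot_res Y X) y V
       (cor_rel Y X V ``
          {(length fs,
            to_sheaf (mtop Y) (tuple_presheaf Y X (cform Y) (length fs)) res_fun V
              (tuple_class V fs))})"

text \<open>
  \<open>H \<circ> h\<close> for \<open>H\<close> in \<open>SCor(Y', X)\<close>: if \<open>H\<close> is given near \<open>h y\<close> by a tuple \<open>{f\<^sub>i}\<close> then \<open>H \<circ> h\<close> is
  given near \<open>y\<close> by \<open>{f\<^sub>i \<circ> h}\<close>. It is meaningful for symplectic embeddings \<open>h\<close>; below it is used
  only for the inclusions of \<open>Y\<close> as a slice of \<open>Y \<times> M\<close>.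
\<close>

definition cor_comp ::
  "('i, 'a, 'e::real_normed_vector) mfd \<Rightarrow> ('k, 'b, 'g::real_normed_vector) mfd \<Rightarrow>
   ('j, 'x, 'f::real_normed_vector) mfd \<Rightarrow> ('b, 'x) cor \<Rightarrow> ('a \<Rightarrow> 'b) \<Rightarrow> ('a, 'x) cor" where
  "cor_comp Y Y' X H h =
     (\<lambda>y\<in>topspace (mtop Y). THE g. \<exists>V n fs.
        openin (mtop Y') V \<and> h y \<in> V \<and> fs \<in> tuples Y' X (cform Y') n V \<and>
        H (h y) = tuple_germ Y' X (h y) V fs \<and>
        g = tuple_germ Y X y {z \<in> topspace (mtop Y). h z \<in> V} (map (\<lambda>f. f \<circ> h) fs))"

definition SC_comp ::
  "('i, 'a, 'e::real_normed_vector) mfd \<Rightarrow> ('k, 'b, 'g::real_normed_vector) mfd \<Rightarrow>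
   ('j, 'x, 'f::real_normed_vector) mfd \<Rightarrow> (('b, 'x) cor \<Rightarrow>\<^sub>0 int) \<Rightarrow> ('a \<Rightarrow> 'b) \<Rightarrow>
   (('a, 'x) cor \<Rightarrow>\<^sub>0 int)" where
  "SC_comp Y Y' X H h = frag_extend (\<lambda>s. frag_of (cor_comp Y Y' X s h)) H"

definition M_homotopic ::
  "('i, 'a, 'e::real_normed_vector) mfd \<Rightarrow> ('j, 'x, 'f::real_normed_vector) mfd \<Rightarrow>
   ('k, 'm, 'g::real_normed_vector) mfd \<Rightarrow> 'm \<Rightarrow> 'm \<Rightarrow>
   (('a, 'x) cor \<Rightarrow>\<^sub>0 int) \<Rightarrow> (('a, 'x) cor \<Rightarrow>\<^sub>0 int) \<Rightarrow> bool" where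
  "M_homotopic Y X M p0 p1 F G \<longleftrightarrow>
     (\<exists>H \<in> carrier (SC (prod_mfd Y M) X).
        SC_comp Y (prod_mfd Y M) X H (\<lambda>y. (y, p0)) = F \<and>
        SC_comp Y (prod_mfd Y M) X H (\<lambda>y. (y, p1)) = G)"

end

(*
  Every F in SC(Y,X) has a constant homotopy: if F is locally {f_i} and I in SCor(M,X) is locally
  {g_j}, the tuples {f_i o pr_Y} together with {g_j o pr_M} define a correspondence on Y x M. On a
  slice Y x p it restricts to {f_i} plus constant maps, which are isotropic, so it restricts to F.
  Writing F*I for this homotopy, symmetry and transitivity are linear algebra in SC(Y x M, X): if
  H joins F to G then F*I + G*I - H joins G to F, and if H' joins G to K then H + H' - G*I joins
  F to K.
*)

theory Submission
  imports Defs
begin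

section \<open>Smooth maps and affine maps\<close>

text \<open>In general no map of \<open>M\<close> exchanges the marked points and two copies of
  \<open>M\<close> cannot be glued, so reversal and concatenation of homotopies are replaced by
  subtraction in the free group; only the constant homotopies need geometry. The obstacle there is
  well-definedness. A section in \<open>SCor\<close> takes values in germs of classes of sections
  that themselves take values in germs, and two tuples may share a germ through a long chain of
  added and removed isotropic tuples. Neither the external sum nor \<open>cor_comp\<close>, a
  definite description, can be evaluated until equality of germs is read back on tuples.
  \<open>tuple_germ_eqI\<close> and \<open>tuple_germ_eqD\<close> do this: germs of tuples at a
  point agree exactly when a chain of \<open>local_step\<close>s at that point joins the tuples. An
  operation on tuples then descends to germs as soon as it sends one step to one step. For the
  external sum and for restriction to a slice this holds because an isotropic tuple stays isotropic
  under pullback along a projection or a slice inclusion.\<close>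

lemma Ck_on_subset: "Ck_on k S f \<Longrightarrow> T \<subseteq> S \<Longrightarrow> Ck_on k T f"
proof (induction k arbitrary: f)
  case 0
  then show ?case by (auto intro: continuous_on_subset)
next
  case (Suc k)
  then show ?case by (simp add: subset_iff)
qed

text \<open>\<open>frechet_derivative\<close> at a point depends on a whole neighbourhood, hence the
  open set. This matters because a local representative is controlled only on a chart image,
  \<open>cinv\<close> being arbitrary elsewhere.\<close>

lemma Ck_on_cong:
  assumes "open S" "Ck_on k S f" "\<And>x. x \<in> S \<Longrightarrow> f x = g x"
  shows "Ck_on k S g"
  using assms(2,3)
proof (induction k arbitrary: f g)
  case 0
  then show ?case using continuous_on_cong by fastforce
next
  case (Suc k)
  have "frechet_derivative f (at x) = frechet_derivative g (at x)" "g differentiable (at x)"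
    if "x \<in> S" for x
  proof -
    have f: "f differentiable (at x)" using Suc.prems that by simp
    then have "(g has_derivative frechet_derivative f (at x)) (at x)"
      using has_derivative_transform_within_open[OF _ assms(1) that] Suc.prems(2)
        frechet_derivative_works by blast
    then show "frechet_derivative f (at x) = frechet_derivative g (at x)" "g differentiable (at x)"
      using frechet_derivative_at differentiable_def by blast+
  qed
  moreover from this have "Ck_on k S (\<lambda>x. frechet_derivative g (at x) v)" for v
    using Suc.IH[of "\<lambda>x. frechet_derivative f (at x) v"] Suc.prems by simp
  ultimately show ?case by simp
qed

lemma has_derivative_affine_comp:
  assumes "bounded_linear L" "f differentiable (at (L x + c))"
  shows "((f \<circ> (\<lambda>x. L x + c)) has_derivative (\<lambda>v. frechet_derivative f (at (L x + c)) (L v))) (at x)"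
proof -
  have "((\<lambda>x. L x + c) has_derivative L) (at x)"
    by (intro has_derivative_add_const bounded_linear_imp_has_derivative assms(1))
  then show ?thesis
    using diff_chain_at[of "\<lambda>x. L x + c" L x f "frechet_derivative f (at (L x + c))"] assms(2)
    by (simp add: o_def frechet_derivative_works)
qed

text \<open>The linear part of an affine map is constant, so the derivative of the composite in
  direction \<open>v\<close> is the derivative of \<open>f\<close> in the fixed direction
  \<open>L v\<close>, composed with the same affine map. The recursion in \<open>Ck_on\<close>
  therefore reproduces itself.\<close>

lemma Ck_on_affine_comp:
  assumes L: "bounded_linear L" and S: "open S" "Ck_on k S f"
  shows "Ck_on k ((\<lambda>x. L x + c) -` S) (f \<circ> (\<lambda>x. L x + c))"
  using S(2)
proof (induction k arbitrary: f)
  case 0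
  have "continuous_on A (\<lambda>x. L x + c)" for A
    by (intro continuous_intros linear_continuous_on L)
  moreover have "continuous_on ((\<lambda>x. L x + c) ` ((\<lambda>x. L x + c) -` S)) f"
    using 0 continuous_on_subset[of S f] by auto
  ultimately show ?case using continuous_on_compose by (metis Ck_on.simps(1))
next
  case (Suc k)
  let ?A = "\<lambda>x. L x + c"
  have op: "open (?A -` S)"
    by (intro continuous_open_vimage S continuous_intros linear_continuous_at L)
  have d: "((f \<circ> ?A) has_derivative (\<lambda>v. frechet_derivative f (at (?A x)) (L v))) (at x)"
    if "x \<in> ?A -` S" for x
    using has_derivative_affine_comp[OF L, of f x c] Suc.prems that by simp
  have "Ck_on k (?A -` S) (\<lambda>x. frechet_derivative (f \<circ> ?A) (at x) v)" for v
  proof (rule Ck_on_cong[OF op])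
    show "Ck_on k (?A -` S) ((\<lambda>x. frechet_derivative f (at x) (L v)) \<circ> ?A)"
      using Suc.IH[of "\<lambda>x. frechet_derivative f (at x) (L v)"] Suc.prems by (simp add: o_def)
    show "((\<lambda>x. frechet_derivative f (at x) (L v)) \<circ> ?A) x = frechet_derivative (f \<circ> ?A) (at x) v"
      if "x \<in> ?A -` S" for x
      using frechet_derivative_at[OF d[OF that]] by (metis o_apply)
  qed
  then show ?case using d unfolding Ck_on.simps differentiable_def by blast
qed


section \<open>Pulling tuples back along maps that are affine in charts\<close>

text \<open>The part of the atlas structure that passes to a product by an argument with open boxes,
  so that the product can be treated on the same footing as its factors.\<close>

definition charted :: "('i, 'a, 'e::real_normed_vector) mfd \<Rightarrow> bool" where
  "charted M \<longleftrightarrow> (\<Union>i\<in>cidx M. cdom M i) = topspace (mtop M) \<and>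
     (\<forall>i\<in>cidx M. openin (mtop M) (cdom M i) \<and> inj_on (cmap M i) (cdom M i) \<and>
        (\<forall>U. openin (mtop M) U \<longrightarrow> U \<subseteq> cdom M i \<longrightarrow> open (cmap M i ` U)))"

lemma charted_smooth_manifold:
  assumes "smooth_manifold M"
  shows "charted M"
proof -
  have "open (cmap M i ` U)" if i: "i \<in> cidx M" and U: "openin (mtop M) U" "U \<subseteq> cdom M i" for i U
  proof -
    have hom: "homeomorphic_map (subtopology (mtop M) (cdom M i))
        (top_of_set (cmap M i ` cdom M i)) (cmap M i)"
      and op: "open (cmap M i ` cdom M i)"
      using assms i by (auto simp: smooth_manifold_def)
    have "openin (subtopology (mtop M) (cdom M i)) U"
      using U by (auto simp: openin_subtopology)
    then have "openin (top_of_set (cmap M i ` cdom M i)) (cmap M i ` U)"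
      using homeomorphic_imp_open_map[OF hom] by (auto simp: open_map_def)
    then show ?thesis using op openin_open_trans by blast
  qed
  moreover have "inj_on (cmap M i) (cdom M i)" if i: "i \<in> cidx M" for i
  proof -
    have "homeomorphic_map (subtopology (mtop M) (cdom M i))
        (top_of_set (cmap M i ` cdom M i)) (cmap M i)" "openin (mtop M) (cdom M i)"
      using assms i by (auto simp: smooth_manifold_def)
    then show ?thesis
      using homeomorphic_imp_injective_map openin_subset by (metis inf.absorb2 topspace_subtopology)
  qed
  ultimately show ?thesis using assms by (auto simp: charted_def smooth_manifold_def)
qed

lemma prod_mfd_simps [simp]:
  "mtop (prod_mfd Y M) = prod_topology (mtop Y) (mtop M)"
  "cidx (prod_mfd Y M) = cidx Y \<times> cidx M"
  "cdom (prod_mfd Y M) (i, j) = cdom Y i \<times> cdom M j"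
  "cmap (prod_mfd Y M) (i, j) (y, m) = (cmap Y i y, cmap M j m)"
  "cform (prod_mfd Y M) (i, j) (x, z) (v, v') (w, w') = cform Y i x v w + cform M j z v' w'"
  by (simp_all add: prod_mfd_def)

lemma charted_prod_mfd:
  assumes Y: "charted Y" and M: "charted M"
  shows "charted (prod_mfd Y M)"
proof -
  have "open (cmap (prod_mfd Y M) (i, j) ` U)"
    if ij: "i \<in> cidx Y" "j \<in> cidx M"
      and U: "openin (prod_topology (mtop Y) (mtop M)) U" "U \<subseteq> cdom Y i \<times> cdom M j" for i j U
  proof (subst open_subopen, rule ballI)
    fix q assume "q \<in> cmap (prod_mfd Y M) (i, j) ` U"
    then obtain y m where "(y, m) \<in> U" and q: "q = cmap (prod_mfd Y M) (i, j) (y, m)" by auto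
    then obtain V W where VW: "openin (mtop Y) V" "openin (mtop M) W" "y \<in> V" "m \<in> W" "V \<times> W \<subseteq> U"
      using U(1) by (metis openin_prod_topology_alt)
    have "V \<times> W \<subseteq> cdom Y i \<times> cdom M j" using VW(5) U(2) by (rule subset_trans)
    then have sub: "V \<subseteq> cdom Y i" "W \<subseteq> cdom M j" using VW(3,4) by (auto simp: times_subset_iff)
    have "open ((cmap Y i ` V) \<times> (cmap M j ` W))"
      using Y M ij VW sub by (intro open_Times) (auto simp: charted_def)
    moreover have "(cmap Y i ` V) \<times> (cmap M j ` W) \<subseteq> cmap (prod_mfd Y M) (i, j) ` U"
    proof
      fix p assume "p \<in> (cmap Y i ` V) \<times> (cmap M j ` W)"
      then obtain v w where "v \<in> V" "w \<in> W" "p = cmap (prod_mfd Y M) (i, j) (v, w)" by auto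
      then show "p \<in> cmap (prod_mfd Y M) (i, j) ` U" using VW(5) by blast
    qed
    ultimately show "\<exists>T. open T \<and> q \<in> T \<and> T \<subseteq> cmap (prod_mfd Y M) (i, j) ` U"
      using VW(3,4) q by (intro exI[of _ "(cmap Y i ` V) \<times> (cmap M j ` W)"]) simp
  qed
  moreover have "inj_on (cmap (prod_mfd Y M) (i, j)) (cdom Y i \<times> cdom M j)"
    if "i \<in> cidx Y" "j \<in> cidx M" for i j
    using Y M that by (auto simp: charted_def inj_on_def)
  moreover have "(\<Union>i\<in>cidx Y \<times> cidx M. cdom (prod_mfd Y M) i) = topspace (mtop Y) \<times> topspace (mtop M)"
  proof -
    have "(\<Union>i\<in>cidx Y \<times> cidx M. cdom (prod_mfd Y M) i)
        = (\<Union>i\<in>cidx Y. cdom Y i) \<times> (\<Union>j\<in>cidx M. cdom M j)" by auto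
    then show ?thesis using Y M by (simp add: charted_def)
  qed
  moreover have "openin (prod_topology (mtop Y) (mtop M)) (cdom Y i \<times> cdom M j)"
    if "i \<in> cidx Y" "j \<in> cidx M" for i j
    using Y M that by (simp add: charted_def openin_prod_Times_iff)
  ultimately show ?thesis
    unfolding charted_def by simp
qed

lemma cinv_cmap: "charted M \<Longrightarrow> i \<in> cidx M \<Longrightarrow> p \<in> cdom M i \<Longrightarrow> cinv M i (cmap M i p) = p"
  by (simp add: charted_def cinv_def)

text \<open>
  The maps needed below, projections, slices and constants, are affine in suitable charts, so
  that no chain rule for general smooth maps is needed.
\<close>

definition chart_affine ::
  "('i, 'a, 'e::real_normed_vector) mfd \<Rightarrow> ('j, 'b, 'g::real_normed_vector) mfd \<Rightarrow>
   ('a \<Rightarrow> 'b) \<Rightarrow> ('i \<Rightarrow> 'j) \<Rightarrow> ('e \<Rightarrow> 'g) \<Rightarrow> 'g \<Rightarrow> bool" where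
  "chart_affine Y Y' h \<sigma> L c \<longleftrightarrow>
     charted Y \<and> charted Y' \<and> continuous_map (mtop Y) (mtop Y') h \<and> bounded_linear L \<and>
     (\<forall>i\<in>cidx Y. \<sigma> i \<in> cidx Y' \<and>
        (\<forall>y\<in>cdom Y i. h y \<in> cdom Y' (\<sigma> i) \<and> cmap Y' (\<sigma> i) (h y) = L (cmap Y i y) + c))"

lemma local_rep_chart_affine:
  assumes "chart_affine Y Y' h \<sigma> L c" "i \<in> cidx Y" "x \<in> cmap Y i ` cdom Y i"
  shows "local_rep Y X (f \<circ> h) i j x = (local_rep Y' X f (\<sigma> i) j \<circ> (\<lambda>x. L x + c)) x"
proof -
  obtain y where y: "y \<in> cdom Y i" "x = cmap Y i y" using assms(3) by blast
  then have "cinv Y i x = y"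
    using assms by (auto simp: chart_affine_def cinv_cmap)
  moreover have "L x + c = cmap Y' (\<sigma> i) (h y)"
    using assms y by (simp add: chart_affine_def)
  moreover have "cinv Y' (\<sigma> i) (cmap Y' (\<sigma> i) (h y)) = h y"
    using assms y by (intro cinv_cmap) (auto simp: chart_affine_def)
  ultimately show ?thesis by (simp add: local_rep_def)
qed

text \<open>Cut down to \<open>topspace (mtop Y)\<close> so as to be literally the domain that
  \<open>cor_comp\<close> gives to a composite tuple.\<close>

definition preim :: "('i, 'a, 'e) mfd \<Rightarrow> ('a \<Rightarrow> 'b) \<Rightarrow> 'b set \<Rightarrow> 'a set" where
  "preim Y h V = {z \<in> topspace (mtop Y). h z \<in> V}"

lemma openin_preim:
  "chart_affine Y Y' h \<sigma> L c \<Longrightarrow> openin (mtop Y') V \<Longrightarrow> openin (mtop Y) (preim Y h V)"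
  by (auto simp: chart_affine_def preim_def openin_continuous_map_preimage)

text \<open>This is the set on which \<open>smooth_map_on\<close> tests a local representative;
  \<open>Ck_on_cong\<close> and \<open>Ck_on_affine_comp\<close> ask for its openness.\<close>

lemma open_chart_image:
  assumes "charted Y" "charted X" "i \<in> cidx Y" "j \<in> cidx X" "openin (mtop Y) U"
    "continuous_map (subtopology (mtop Y) U) (mtop X) f"
  shows "open (cmap Y i ` {y \<in> U \<inter> cdom Y i. f y \<in> cdom X j})"
proof -
  have "openin (mtop X) (cdom X j)" "openin (mtop Y) (cdom Y i)"
    using assms by (auto simp: charted_def)
  then have "openin (subtopology (mtop Y) U)
      {y \<in> topspace (subtopology (mtop Y) U). f y \<in> cdom X j}"
    using assms(6) openin_continuous_map_preimage by blast
  then have "openin (mtop Y) {y \<in> topspace (subtopology (mtop Y) U). f y \<in> cdom X j}"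
    using assms(5) openin_trans_full by blast
  then have "openin (mtop Y) ({y \<in> topspace (subtopology (mtop Y) U). f y \<in> cdom X j} \<inter> cdom Y i)"
    using \<open>openin (mtop Y) (cdom Y i)\<close> by blast
  moreover have "{y \<in> topspace (subtopology (mtop Y) U). f y \<in> cdom X j} \<inter> cdom Y i
      = {y \<in> U \<inter> cdom Y i. f y \<in> cdom X j}"
    using openin_subset[OF assms(5)] by auto
  ultimately show ?thesis
    using assms(1,3) by (auto simp: charted_def)
qed

lemma smooth_map_on_chart_affine_comp:
  assumes h: "chart_affine Y Y' h \<sigma> L c" and X: "charted X"
    and V: "openin (mtop Y') V" and f: "smooth_map_on Y' X V f"
  shows "smooth_map_on Y X (preim Y h V) (f \<circ> h)"
proof -
  have fc: "continuous_map (subtopology (mtop Y') V) (mtop X) f"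
    using f by (simp add: smooth_map_on_def)
  have "continuous_map (subtopology (mtop Y) (preim Y h V)) (subtopology (mtop Y') V) h"
    using h by (auto simp: chart_affine_def preim_def continuous_map_in_subtopology
        intro: continuous_map_from_subtopology)
  then have c: "continuous_map (subtopology (mtop Y) (preim Y h V)) (mtop X) (f \<circ> h)"
    using fc continuous_map_compose by blast
  have "smooth_on (cmap Y i ` {y \<in> preim Y h V \<inter> cdom Y i. (f \<circ> h) y \<in> cdom X j})
      (local_rep Y X (f \<circ> h) i j)" if ij: "i \<in> cidx Y" "j \<in> cidx X" for i j
    unfolding smooth_on_def
  proof
    fix k
    let ?T = "cmap Y i ` {y \<in> preim Y h V \<inter> cdom Y i. (f \<circ> h) y \<in> cdom X j}"
    let ?S = "cmap Y' (\<sigma> i) ` {y \<in> V \<inter> cdom Y' (\<sigma> i). f y \<in> cdom X j}"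
    have \<sigma>: "\<sigma> i \<in> cidx Y'" using h ij by (auto simp: chart_affine_def)
    have S: "open ?S"
      using open_chart_image[OF _ X \<sigma> ij(2) V fc] h by (simp add: chart_affine_def)
    have T: "open ?T"
      using open_chart_image[OF _ X ij openin_preim[OF h V] c] h by (simp add: chart_affine_def)
    have "Ck_on k ?S (local_rep Y' X f (\<sigma> i) j)"
      using f \<sigma> ij by (auto simp: smooth_map_on_def smooth_on_def)
    then have "Ck_on k ((\<lambda>x. L x + c) -` ?S) (local_rep Y' X f (\<sigma> i) j \<circ> (\<lambda>x. L x + c))"
      using Ck_on_affine_comp S h by (auto simp: chart_affine_def)
    moreover have "?T \<subseteq> (\<lambda>x. L x + c) -` ?S"
    proof
      fix x assume "x \<in> ?T"
      then obtain y where y: "x = cmap Y i y" "y \<in> cdom Y i" "h y \<in> V" "f (h y) \<in> cdom X j"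
        by (auto simp: preim_def)
      moreover have "h y \<in> cdom Y' (\<sigma> i)" "cmap Y' (\<sigma> i) (h y) = L x + c"
        using h ij(1) y(1,2) by (simp_all add: chart_affine_def)
      ultimately show "x \<in> (\<lambda>x. L x + c) -` ?S" by (auto simp: image_iff)
    qed
    ultimately have "Ck_on k ?T (local_rep Y' X f (\<sigma> i) j \<circ> (\<lambda>x. L x + c))"
      using Ck_on_subset by blast
    then show "Ck_on k ?T (local_rep Y X (f \<circ> h) i j)"
    proof (rule Ck_on_cong[OF T])
      fix x assume "x \<in> ?T"
      then show "(local_rep Y' X f (\<sigma> i) j \<circ> (\<lambda>x. L x + c)) x = local_rep Y X (f \<circ> h) i j x"
        by (intro local_rep_chart_affine[OF h ij(1), symmetric]) auto
    qed
  qed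
  then show ?thesis using c by (auto simp: smooth_map_on_def)
qed

text \<open>Both sides select their chart of \<open>X\<close> from the same point
  \<open>f (h y)\<close>, so the choice in \<open>pullback_form\<close> returns the same
  \<open>j\<close> and independence of the chart never has to be shown. What remains is one chain
  rule with the constant derivative \<open>L\<close>.\<close>

lemma pullback_form_chart_affine_comp:
  assumes h: "chart_affine Y Y' h \<sigma> L c" and X: "charted X"
    and V: "openin (mtop Y') V" and f: "smooth_map_on Y' X V f"
    and i: "i \<in> cidx Y" and y: "y \<in> preim Y h V \<inter> cdom Y i"
  shows "pullback_form Y X (f \<circ> h) i y v w = pullback_form Y' X f (\<sigma> i) (h y) (L v) (L w)"
proof -
  define j where "j = (SOME j. j \<in> cidx X \<and> f (h y) \<in> cdom X j)"
  have \<sigma>: "\<sigma> i \<in> cidx Y'" using h i by (auto simp: chart_affine_def)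
  have hy: "h y \<in> V" "h y \<in> cdom Y' (\<sigma> i)" "cmap Y' (\<sigma> i) (h y) = L (cmap Y i y) + c"
    using h i y by (auto simp: chart_affine_def preim_def)
  have "f (h y) \<in> topspace (mtop X)"
    using f hy(1) openin_subset[OF V]
    by (auto simp: smooth_map_on_def continuous_map_def Pi_iff subset_iff)
  then have "\<exists>j. j \<in> cidx X \<and> f (h y) \<in> cdom X j"
    using X unfolding charted_def by blast
  then have j: "j \<in> cidx X" "f (h y) \<in> cdom X j"
    unfolding j_def by (metis (mono_tags, lifting) someI_ex)+
  let ?f = "local_rep Y' X f (\<sigma> i) j" and ?g = "local_rep Y X (f \<circ> h) i j"
  have "Ck_on (Suc 0) (cmap Y' (\<sigma> i) ` {y \<in> V \<inter> cdom Y' (\<sigma> i). f y \<in> cdom X j}) ?f"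
    using f \<sigma> j(1) unfolding smooth_map_on_def smooth_on_def by blast
  then have "?f differentiable (at (cmap Y' (\<sigma> i) (h y)))"
    using hy(1,2) j(2) by simp
  then have "((?f \<circ> (\<lambda>x. L x + c)) has_derivative
      (\<lambda>v. frechet_derivative ?f (at (cmap Y' (\<sigma> i) (h y))) (L v))) (at (cmap Y i y))"
    using has_derivative_affine_comp[of L ?f "cmap Y i y" c] hy(3) h by (simp add: chart_affine_def)
  moreover have "open (cmap Y i ` cdom Y i)"
    using h i by (auto simp: chart_affine_def charted_def)
  ultimately have "(?g has_derivative
      (\<lambda>v. frechet_derivative ?f (at (cmap Y' (\<sigma> i) (h y))) (L v))) (at (cmap Y i y))"
    by (rule has_derivative_transform_within_open)
      (use y local_rep_chart_affine[OF h i, of _ X f j] in auto)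
  then have D: "frechet_derivative ?g (at (cmap Y i y)) v =
      frechet_derivative ?f (at (cmap Y' (\<sigma> i) (h y))) (L v)" for v
    using frechet_derivative_at by metis
  show ?thesis
    using D by (simp add: pullback_form_def Let_def flip: j_def)
qed

text \<open>With both target forms arbitrary, one statement covers symplectic tuples along slices,
  the summands of the product form along projections, isotropic tuples, and constant maps, where
  \<open>L = 0\<close> turns a symplectic tuple into an isotropic one.\<close>

lemma tuples_chart_affine_comp:
  assumes h: "chart_affine Y Y' h \<sigma> L c" and X: "charted X" and V: "openin (mtop Y') V"
    and fs: "fs \<in> tuples Y' X \<eta>' n V"
    and \<eta>: "\<And>i y v w. i \<in> cidx Y \<Longrightarrow> y \<in> cdom Y i \<Longrightarrow>
      \<eta>' (\<sigma> i) (cmap Y' (\<sigma> i) (h y)) (L v) (L w) = \<eta> i (cmap Y i y) v w"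
  shows "map (\<lambda>f. f \<circ> h) fs \<in> tuples Y X \<eta> n (preim Y h V)"
proof -
  have sm: "smooth_map_on Y' X V f" if "f \<in> set fs" for f
    using fs that by (simp add: tuples_def)
  have "(\<Sum>f\<leftarrow>fs. pullback_form Y X (f \<circ> h) i y v w) = \<eta> i (cmap Y i y) v w"
    if i: "i \<in> cidx Y" and y: "y \<in> preim Y h V \<inter> cdom Y i" for i y v w
  proof -
    have "(\<Sum>f\<leftarrow>fs. pullback_form Y X (f \<circ> h) i y v w)
        = (\<Sum>f\<leftarrow>fs. pullback_form Y' X f (\<sigma> i) (h y) (L v) (L w))"
      using pullback_form_chart_affine_comp[OF h X V sm i y]
      by (intro arg_cong[of _ _ sum_list] map_cong) auto
    also have "\<dots> = \<eta>' (\<sigma> i) (cmap Y' (\<sigma> i) (h y)) (L v) (L w)"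
      using fs i y h by (auto simp: tuples_def chart_affine_def preim_def)
    finally show ?thesis using \<eta> i y by simp
  qed
  then show ?thesis
    using fs sm smooth_map_on_chart_affine_comp[OF h X V]
    by (auto simp: tuples_def o_def)
qed

section \<open>Restriction and concatenation of tuples\<close>

lemma tuples_subset:
  assumes "fs \<in> tuples Y X \<eta> n V" "W \<subseteq> V"
  shows "fs \<in> tuples Y X \<eta> n W"
proof -
  have "smooth_map_on Y X W f" if f: "smooth_map_on Y X V f" for f
  proof -
    have "smooth_on (cmap Y i ` {y \<in> W \<inter> cdom Y i. f y \<in> cdom X j}) (local_rep Y X f i j)"
      if "i \<in> cidx Y" "j \<in> cidx X" for i j
    proof -
      have "cmap Y i ` {y \<in> W \<inter> cdom Y i. f y \<in> cdom X j}
          \<subseteq> cmap Y i ` {y \<in> V \<inter> cdom Y i. f y \<in> cdom X j}"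
        using assms(2) by blast
      then show ?thesis
        using f that Ck_on_subset unfolding smooth_map_on_def smooth_on_def by blast
    qed
    then show ?thesis
      using f assms(2) continuous_map_from_subtopology_mono
      by (auto simp: smooth_map_on_def)
  qed
  then show ?thesis using assms by (auto simp: tuples_def)
qed

lemma tuples_append:
  "fs \<in> tuples Y X \<eta>1 n V \<Longrightarrow> gs \<in> tuples Y X \<eta>2 m V \<Longrightarrow>
   (\<And>i y v w. i \<in> cidx Y \<Longrightarrow> y \<in> cdom Y i \<Longrightarrow>
      \<eta> i (cmap Y i y) v w = \<eta>1 i (cmap Y i y) v w + \<eta>2 i (cmap Y i y) v w) \<Longrightarrow>
   fs @ gs \<in> tuples Y X \<eta> (n + m) V"
  by (auto simp: tuples_def)

lemma length_tuples: "fs \<in> tuples Y X \<eta> n V \<Longrightarrow> length fs = n"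
  by (simp add: tuples_def)


section \<open>Germs of correspondences\<close>

text \<open>Transitivity of agreement near a point rests on this law. It is kept abstract because
  germs are formed twice, for tuples with \<open>res_fun\<close> and for their classes with
  \<open>quot_res\<close>.\<close>

definition functorial_res :: "'a topology \<Rightarrow> ('a set \<Rightarrow> 's set) \<Rightarrow> ('a set \<Rightarrow> 's \<Rightarrow> 's) \<Rightarrow> bool" where
  "functorial_res T P res \<longleftrightarrow>
     (\<forall>V W W' F. openin T V \<longrightarrow> openin T W \<longrightarrow> openin T W' \<longrightarrow> W' \<subseteq> W \<longrightarrow> W \<subseteq> V \<longrightarrow> F \<in> P V \<longrightarrow>
        res W' (res W F) = res W' F)"

text \<open>If \<open>F\<close> agrees with \<open>G\<close> on \<open>W\<close> and with
  \<open>K\<close> on \<open>W'\<close>, then all three agree on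
  \<open>W \<inter> W'\<close>.\<close>

lemma germ_subset:
  assumes res: "functorial_res T P res"
    and U: "openin T U" "F \<in> P U" and V: "openin T V" "G \<in> P V"
    and W: "openin T W" "z \<in> W" "W \<subseteq> U \<inter> V" "res W F = res W G"
  shows "germ T P res z U F \<subseteq> germ T P res z V G"
proof
  fix p assume "p \<in> germ T P res z U F"
  then obtain V' K W' where K: "p = (V', K)" "openin T V'" "z \<in> V'" "K \<in> P V'"
    and W': "openin T W'" "z \<in> W'" "W' \<subseteq> U \<inter> V'" "res W' F = res W' K"
    unfolding germ_def by blast
  have I: "openin T (W \<inter> W')" using W(1) W'(1) by blast
  have "res (W \<inter> W') G = res (W \<inter> W') (res W G)"
    using res V W(1,3) I unfolding functorial_res_def by (metis inf.bounded_iff inf_le1)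
  also have "\<dots> = res (W \<inter> W') F"
    using res U W I unfolding functorial_res_def by (metis inf.bounded_iff inf_le1)
  also have "\<dots> = res (W \<inter> W') (res W' F)"
    using res U W'(1,3) I unfolding functorial_res_def by (metis inf.bounded_iff inf_le2)
  also have "\<dots> = res (W \<inter> W') K"
    using res K W' I unfolding functorial_res_def by (metis inf.bounded_iff inf_le2)
  finally have "res (W \<inter> W') G = res (W \<inter> W') K" .
  moreover have "z \<in> W \<inter> W'" "W \<inter> W' \<subseteq> V \<inter> V'" using W W' by auto
  ultimately show "p \<in> germ T P res z V G"
    using K I unfolding germ_def by blast
qed

lemma germ_eqI:
  assumes "functorial_res T P res"
    and "openin T U" "F \<in> P U" and "openin T V" "G \<in> P V"
    and "openin T W" "z \<in> W" "W \<subseteq> U \<inter> V" "res W F = res W G"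
  shows "germ T P res z U F = germ T P res z V G"
  using germ_subset[OF assms] germ_subset[OF assms(1,4,5,2,3,6,7), unfolded Int_commute[of V]] assms
  by auto

lemma germ_eqD:
  assumes "germ T P res z U F = germ T P res z V G" "openin T U" "z \<in> U" "F \<in> P U"
  shows "\<exists>W. openin T W \<and> z \<in> W \<and> W \<subseteq> U \<inter> V \<and> res W F = res W G"
proof -
  have "(U, F) \<in> germ T P res z U F" using assms(2-4) by (auto simp: germ_def)
  then have "(U, F) \<in> germ T P res z V G" using assms(1) by simp
  then show ?thesis unfolding germ_def by auto
qed

section \<open>Tuples as local data for sections in \<open>Cor_n\<close>\<close>

lemma functorial_res_fun: "functorial_res T P res_fun"
  by (auto simp: functorial_res_def Int_absorb1)

lemma restrict_tuple_class: "W \<subseteq> V \<Longrightarrow> restrict (tuple_class V fs) W = tuple_class W fs"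
  by (auto simp: tuple_class_def restrict_def fun_eq_iff)

lemma tuple_class_in_presheaf:
  "fs \<in> tuples Y X \<eta> n V \<Longrightarrow> tuple_class V fs \<in> tuple_presheaf Y X \<eta> n V"
  by (simp add: tuple_presheaf_def)

lemma germ_tuple_class_subset:
  assumes "openin (mtop Y) V" "openin (mtop Y) W" "W \<subseteq> V" "z \<in> W" "fs \<in> tuples Y X \<eta> n V"
  shows "germ (mtop Y) (tuple_presheaf Y X \<eta> n) res_fun z V (tuple_class V fs) =
    germ (mtop Y) (tuple_presheaf Y X \<eta> n) res_fun z W (tuple_class W fs)"
  using assms
  by (intro germ_eqI[OF functorial_res_fun, where W = W] tuple_class_in_presheaf
      tuples_subset[OF assms(5,3)]) (auto simp: restrict_tuple_class)

lemma Cor_n_local: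
  assumes "F \<in> Cor_n Y X \<eta> n U" "y \<in> U"
  obtains V fs where "openin (mtop Y) V" "y \<in> V" "V \<subseteq> U" "fs \<in> tuples Y X \<eta> n V"
    "\<And>z. z \<in> V \<Longrightarrow> F z = germ (mtop Y) (tuple_presheaf Y X \<eta> n) res_fun z V (tuple_class V fs)"
proof -
  have "\<exists>V G. openin (mtop Y) V \<and> y \<in> V \<and> V \<subseteq> U \<and> G \<in> tuple_presheaf Y X \<eta> n V \<and>
      (\<forall>z\<in>V. F z = germ (mtop Y) (tuple_presheaf Y X \<eta> n) res_fun z V G)"
    using assms by (simp add: Cor_n_def sheafify_def)
  then obtain V G where "openin (mtop Y) V" "y \<in> V" "V \<subseteq> U" "G \<in> tuple_presheaf Y X \<eta> n V"
      "\<forall>z\<in>V. F z = germ (mtop Y) (tuple_presheaf Y X \<eta> n) res_fun z V G"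
    by blast
  moreover from this(4) obtain fs where "fs \<in> tuples Y X \<eta> n V" "G = tuple_class V fs"
    by (auto simp: tuple_presheaf_def)
  ultimately show ?thesis using that by simp
qed

lemma to_sheaf_in_Cor_n:
  assumes "openin (mtop Y) V" "fs \<in> tuples Y X \<eta> n V"
  shows "to_sheaf (mtop Y) (tuple_presheaf Y X \<eta> n) res_fun V (tuple_class V fs) \<in> Cor_n Y X \<eta> n V"
  unfolding Cor_n_def sheafify_def to_sheaf_def
  using assms(1) tuple_class_in_presheaf[OF assms(2)]
  by (auto intro!: exI[of _ V] exI[of _ "tuple_class V fs"])

lemma restrict_to_sheaf_tuple_class:
  assumes "openin (mtop Y) V" "openin (mtop Y) W" "W \<subseteq> V" "fs \<in> tuples Y X \<eta> n V"
  shows "restrict (to_sheaf (mtop Y) (tuple_presheaf Y X \<eta> n) res_fun V (tuple_class V fs)) W =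
    to_sheaf (mtop Y) (tuple_presheaf Y X \<eta> n) res_fun W (tuple_class W fs)"
  unfolding to_sheaf_def
  using germ_tuple_class_subset[OF assms(1-3) _ assms(4)] assms(3)
  by (auto simp: restrict_def fun_eq_iff)

lemma Cor_n_restrict:
  assumes F: "F \<in> Cor_n Y X \<eta> n U" and W: "openin (mtop Y) W" "W \<subseteq> U"
  shows "restrict F W \<in> Cor_n Y X \<eta> n W"
  unfolding Cor_n_def sheafify_def
proof (intro CollectI conjI ballI)
  fix y assume y: "y \<in> W"
  then have "y \<in> U" using W(2) by blast
  obtain V fs where V: "openin (mtop Y) V" "y \<in> V" "V \<subseteq> U" "fs \<in> tuples Y X \<eta> n V"
    and eq: "\<And>z. z \<in> V \<Longrightarrow>
      F z = germ (mtop Y) (tuple_presheaf Y X \<eta> n) res_fun z V (tuple_class V fs)"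
    by (rule Cor_n_local[OF F \<open>y \<in> U\<close>]) (rule that)
  have op: "openin (mtop Y) (V \<inter> W)" using V W by blast
  have "restrict F W z =
      germ (mtop Y) (tuple_presheaf Y X \<eta> n) res_fun z (V \<inter> W) (tuple_class (V \<inter> W) fs)"
    if "z \<in> V \<inter> W" for z
    using germ_tuple_class_subset[OF V(1) op _ that V(4)] eq that by simp
  moreover have "tuple_class (V \<inter> W) fs \<in> tuple_presheaf Y X \<eta> n (V \<inter> W)"
    using tuple_class_in_presheaf tuples_subset[OF V(4)] by blast
  ultimately show "\<exists>V G. openin (mtop Y) V \<and> y \<in> V \<and> V \<subseteq> W \<and> G \<in> tuple_presheaf Y X \<eta> n V \<and>
      (\<forall>z\<in>V. restrict F W z = germ (mtop Y) (tuple_presheaf Y X \<eta> n) res_fun z V G)"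
    using op y V(2) by (intro exI[of _ "V \<inter> W"] exI[of _ "tuple_class (V \<inter> W) fs"]) simp
qed simp

lemma is_concat_restrict:
  assumes c: "is_concat Y X U n F m G H" and W: "openin (mtop Y) W" "W \<subseteq> U"
  shows "is_concat Y X W n (restrict F W) m (restrict G W) (restrict H W)"
  unfolding is_concat_def
proof
  fix y assume y: "y \<in> W"
  then have "y \<in> U" using W(2) by blast
  from bspec[OF c[unfolded is_concat_def] this] obtain V fs gs where V: "openin (mtop Y) V" "y \<in> V" "V \<subseteq> U"
    and fs: "fs \<in> tuples Y X (cform Y) n V" and gs: "gs \<in> tuples Y X no_form m V"
    and eq: "F y = germ (mtop Y) (tuple_presheaf Y X (cform Y) n) res_fun y V (tuple_class V fs)"
      "G y = germ (mtop Y) (tuple_presheaf Y X no_form m) res_fun y V (tuple_class V gs)"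
      "H y = germ (mtop Y) (tuple_presheaf Y X (cform Y) (n + m)) res_fun y V
         (tuple_class V (fs @ gs))"
    by blast
  have fgs: "fs @ gs \<in> tuples Y X (cform Y) (n + m) V"
    using tuples_append[OF fs gs] by (simp add: no_form_def)
  have op: "openin (mtop Y) (V \<inter> W)" and yVW: "y \<in> V \<inter> W" using V W y by auto
  note sub = germ_tuple_class_subset[OF V(1) op inf_le1 yVW]
  show "\<exists>V fs gs. openin (mtop Y) V \<and> y \<in> V \<and> V \<subseteq> W \<and>
      fs \<in> tuples Y X (cform Y) n V \<and> gs \<in> tuples Y X no_form m V \<and>
      restrict F W y = germ (mtop Y) (tuple_presheaf Y X (cform Y) n) res_fun y V (tuple_class V fs) \<and>
      restrict G W y = germ (mtop Y) (tuple_presheaf Y X no_form m) res_fun y V (tuple_class V gs) \<and>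
      restrict H W y = germ (mtop Y) (tuple_presheaf Y X (cform Y) (n + m)) res_fun y V
        (tuple_class V (fs @ gs))"
    using op yVW y eq sub[OF fs] sub[OF gs] sub[OF fgs]
      tuples_subset[OF fs inf_le1] tuples_subset[OF gs inf_le1]
    by (intro exI[of _ "V \<inter> W"] exI[of _ fs] exI[of _ gs]) simp
qed

section \<open>Restriction of classes modulo isotropic correspondences\<close>

definition cor_restrict :: "'a set \<Rightarrow> nat \<times> ('a, 'x) ncor \<Rightarrow> nat \<times> ('a, 'x) ncor" where
  "cor_restrict V = (\<lambda>(n, F). (n, restrict F V))"

lemma cor_step_restrict:
  assumes "cor_step Y X U a b" "openin (mtop Y) W" "W \<subseteq> U"
  shows "cor_step Y X W (cor_restrict W a) (cor_restrict W b)"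
  using assms(1)
proof cases
  case (1 F n G m H)
  then show ?thesis
    using assms(2,3) Cor_n_restrict is_concat_restrict
    by (auto simp: cor_restrict_def intro!: cor_step.intros)
qed

lemma equivclp_map:
  assumes "equivclp r a b" "\<And>x y. r x y \<Longrightarrow> equivclp s (f x) (f y)"
  shows "equivclp s (f a) (f b)"
  using assms(1)
proof (induction rule: equivclp_induct)
  case (step y z)
  then show ?case using assms(2) equivclp_trans equivclp_sym by metis
qed simp

text \<open>Concatenations restrict to concatenations, so every member of the class of
  \<open>a\<close> restricts to something linked with the restriction of \<open>a\<close>. The
  saturation in \<open>quot_res\<close> hence yields a single class.\<close>

lemma quot_res_class:
  assumes "openin (mtop Y) W" "W \<subseteq> U"
  shows "quot_res Y X W (cor_rel Y X U `` {a}) = cor_rel Y X W `` {cor_restrict W a}"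
proof -
  have "equivclp (cor_step Y X W) (cor_restrict W a) (cor_restrict W b)"
    if "equivclp (cor_step Y X U) a b" for b
    using that cor_step_restrict[OF _ assms] by (blast intro: equivclp_map)
  moreover have "equivclp (cor_step Y X U) a a" by simp
  ultimately show ?thesis
    unfolding quot_res_def cor_rel_def cor_restrict_def[symmetric] Image_def image_def
    by (blast intro: equivclp_trans)
qed

lemma functorial_quot_res: "functorial_res (mtop Y) (quot_presheaf Y X) (quot_res Y X)"
proof -
  have "quot_res Y X W' (quot_res Y X W C) = quot_res Y X W' C"
    if "openin (mtop Y) W" "openin (mtop Y) W'" "W' \<subseteq> W" "W \<subseteq> V" "C \<in> quot_presheaf Y X V"
    for V W W' C
  proof -
    obtain n F where C: "C = cor_rel Y X V `` {(n, F)}"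
      using \<open>C \<in> _\<close> unfolding quot_presheaf_def quotient_def by auto
    have "W' \<subseteq> V" using \<open>W' \<subseteq> W\<close> \<open>W \<subseteq> V\<close> by blast
    then show ?thesis
      using \<open>openin (mtop Y) W\<close> \<open>openin (mtop Y) W'\<close> \<open>W' \<subseteq> W\<close> \<open>W \<subseteq> V\<close>
      unfolding C by (simp add: quot_res_class cor_restrict_def Int_absorb1)
  qed
  then show ?thesis unfolding functorial_res_def by blast
qed

text \<open>
  \<open>local_step\<close> is the relation on tuples near \<open>y\<close> whose equivalence closure is equality of the
  germs in \<open>SCor\<close>; the case \<open>gs = []\<close> covers the identification of tuples with equal values.
\<close>

definition local_cor ::
  "('i, 'a, 'e::real_normed_vector) mfd \<Rightarrow> ('j, 'x, 'f::real_normed_vector) mfd \<Rightarrow> 'a \<Rightarrow>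
   'a set \<times> ('a \<Rightarrow> 'x) list \<Rightarrow> bool" where
  "local_cor Y X y = (\<lambda>(V, fs). openin (mtop Y) V \<and> y \<in> V \<and> fs \<in> tuples Y X (cform Y) (length fs) V)"

definition local_step ::
  "('i, 'a, 'e::real_normed_vector) mfd \<Rightarrow> ('j, 'x, 'f::real_normed_vector) mfd \<Rightarrow> 'a \<Rightarrow>
   'a set \<times> ('a \<Rightarrow> 'x) list \<Rightarrow> 'a set \<times> ('a \<Rightarrow> 'x) list \<Rightarrow> bool" where
  "local_step Y X y = (\<lambda>(V, fs) (V', fs'). local_cor Y X y (V, fs) \<and> local_cor Y X y (V', fs') \<and>
     (\<exists>W gs. openin (mtop Y) W \<and> y \<in> W \<and> W \<subseteq> V \<inter> V' \<and> gs \<in> tuples Y X no_form (length gs) W \<and>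
        (\<forall>z\<in>W. mset (map (\<lambda>f. f z) fs') = mset (map (\<lambda>f. f z) (fs @ gs)))))"

lemma local_step_refl:
  assumes "local_cor Y X y (V, fs)" "local_cor Y X y (V', fs')"
    "openin (mtop Y) W" "y \<in> W" "W \<subseteq> V \<inter> V'"
    "\<And>z. z \<in> W \<Longrightarrow> mset (map (\<lambda>f. f z) fs') = mset (map (\<lambda>f. f z) fs)"
  shows "local_step Y X y (V, fs) (V', fs')"
proof -
  have "[] \<in> tuples Y X no_form (length []) W" by (simp add: tuples_def no_form_def)
  then show ?thesis using assms unfolding local_step_def
    by (auto intro!: exI[of _ W] exI[of _ "[]"])
qed

abbreviation cor_of :: "('i, 'a, 'e::real_normed_vector) mfd \<Rightarrow> ('j, 'x, 'f::real_normed_vector) mfd \<Rightarrow>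
  'a set \<Rightarrow> ('a \<Rightarrow> 'x) list \<Rightarrow> nat \<times> ('a, 'x) ncor" where
  "cor_of Y X V fs \<equiv> (length fs,
     to_sheaf (mtop Y) (tuple_presheaf Y X (cform Y) (length fs)) res_fun V (tuple_class V fs))"

lemma cor_of_in_quot_presheaf:
  assumes "local_cor Y X y (V, fs)"
  shows "cor_rel Y X V `` {cor_of Y X V fs} \<in> quot_presheaf Y X V"
proof -
  have "cor_of Y X V fs \<in> cor_union Y X V"
    using assms to_sheaf_in_Cor_n by (auto simp: cor_union_def local_cor_def)
  then show ?thesis by (simp add: quot_presheaf_def quotientI)
qed

lemma cor_restrict_cor_of:
  assumes "local_cor Y X y (V, fs)" "openin (mtop Y) W" "W \<subseteq> V"
  shows "cor_restrict W (cor_of Y X V fs) = cor_of Y X W fs"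
proof -
  have "openin (mtop Y) V" "fs \<in> tuples Y X (cform Y) (length fs) V"
    using assms(1) by (simp_all add: local_cor_def)
  then show ?thesis
    using restrict_to_sheaf_tuple_class[OF _ assms(2,3)] by (simp add: cor_restrict_def)
qed

lemma quot_res_cor_of:
  assumes "local_cor Y X y (V, fs)" "openin (mtop Y) W" "W \<subseteq> V"
  shows "quot_res Y X W (cor_rel Y X V `` {cor_of Y X V fs}) = cor_rel Y X W `` {cor_of Y X W fs}"
  by (simp only: quot_res_class[OF assms(2,3)] cor_restrict_cor_of[OF assms])

text \<open>Over the common neighbourhood \<open>W\<close> a local step is an honest concatenation
  with an isotropic section, that is, one \<open>cor_step\<close>, and both tuples define the same
  class there.\<close>

lemma tuple_germ_eqI:
  assumes "local_step Y X y (V, fs) (V', fs')"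
  shows "tuple_germ Y X y V fs = tuple_germ Y X y V' fs'"
proof -
  obtain W gs where W: "openin (mtop Y) W" "y \<in> W" "W \<subseteq> V \<inter> V'"
    and gs: "gs \<in> tuples Y X no_form (length gs) W"
    and eq: "\<And>z. z \<in> W \<Longrightarrow> mset (map (\<lambda>f. f z) fs') = mset (map (\<lambda>f. f z) (fs @ gs))"
    and loc: "local_cor Y X y (V, fs)" "local_cor Y X y (V', fs')"
    using assms unfolding local_step_def by auto
  have fs: "fs \<in> tuples Y X (cform Y) (length fs) W"
    and fs': "fs' \<in> tuples Y X (cform Y) (length fs') W"
    using tuples_subset[of fs Y X "cform Y" "length fs" V W]
      tuples_subset[of fs' Y X "cform Y" "length fs'" V' W] loc W(3)
    by (simp_all add: local_cor_def)
  have tc: "tuple_class W fs' = tuple_class W (fs @ gs)"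
    using eq by (auto simp: tuple_class_def restrict_def fun_eq_iff)
  \<comment> \<open>\<open>W\<close> contains \<open>y\<close>, so comparing the two multisets at
    that single point determines the length of \<open>fs'\<close>.\<close>
  have len: "length fs' = length fs + length gs"
    using arg_cong[OF eq[OF W(2)], of size] by simp
  let ?F = "\<lambda>\<eta> fs. to_sheaf (mtop Y) (tuple_presheaf Y X \<eta> (length fs)) res_fun W (tuple_class W fs)"
  have "is_concat Y X W (length fs) (?F (cform Y) fs) (length gs) (?F no_form gs) (?F (cform Y) fs')"
    unfolding is_concat_def to_sheaf_def
    by (rule ballI, rule exI[of _ W], rule exI[of _ fs], rule exI[of _ gs])
      (simp add: W(1) fs gs len tc)
  moreover have "?F (cform Y) fs' \<in> SCor_n Y X (length fs + length gs) W"
    using to_sheaf_in_Cor_n[OF W(1) fs'] by (simp only: len)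
  ultimately have "cor_step Y X W (cor_of Y X W fs) (length fs + length gs, ?F (cform Y) fs')"
    using to_sheaf_in_Cor_n[OF W(1) fs] to_sheaf_in_Cor_n[OF W(1) gs]
    by (intro cor_step.intros)
  then have "equivclp (cor_step Y X W) (cor_of Y X W fs) (cor_of Y X W fs')"
    unfolding len by (rule r_into_equivclp)
  then have "cor_rel Y X W `` {cor_of Y X W fs} = cor_rel Y X W `` {cor_of Y X W fs'}"
    unfolding cor_rel_def by (auto intro: equivclp_trans equivclp_sym)
  then have "quot_res Y X W (cor_rel Y X V `` {cor_of Y X V fs}) =
      quot_res Y X W (cor_rel Y X V' `` {cor_of Y X V' fs'})"
    using quot_res_cor_of[OF loc(1) W(1)] quot_res_cor_of[OF loc(2) W(1)] W(3) by simp
  then show ?thesis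
    unfolding tuple_germ_def using W loc
    by (intro germ_eqI[OF functorial_quot_res, where W = W] cor_of_in_quot_presheaf)
      (auto simp: local_cor_def)
qed

text \<open>A section of the sheafified tuple presheaf need not come from one tuple on its whole
  domain. Recording a tuple near \<open>y\<close> allows a \<open>cor_step\<close> between sections
  to be read as a step between tuples.\<close>

definition represents ::
  "('i, 'a, 'e::real_normed_vector) mfd \<Rightarrow> ('j, 'x, 'f::real_normed_vector) mfd \<Rightarrow> 'a \<Rightarrow>
   nat \<times> ('a, 'x) ncor \<Rightarrow> 'a set \<times> ('a \<Rightarrow> 'x) list \<Rightarrow> bool" where
  "represents Y X y = (\<lambda>(n, F) (V, fs). local_cor Y X y (V, fs) \<and> length fs = n \<and>
     F y = germ (mtop Y) (tuple_presheaf Y X (cform Y) n) res_fun y V (tuple_class V fs))"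

text \<open>Two tuples with the germ of the same section have equal values near \<open>y\<close>,
  which is a step with no isotropic summand.\<close>

lemma represents_unique:
  assumes "represents Y X y a p" "represents Y X y a q"
  shows "local_step Y X y p q"
proof -
  obtain n F V fs V' fs' where [simp]: "a = (n, F)" "p = (V, fs)" "q = (V', fs')"
    by (metis surj_pair)
  have loc: "local_cor Y X y (V, fs)" "local_cor Y X y (V', fs')"
    and eq: "germ (mtop Y) (tuple_presheaf Y X (cform Y) n) res_fun y V (tuple_class V fs) =
      germ (mtop Y) (tuple_presheaf Y X (cform Y) n) res_fun y V' (tuple_class V' fs')"
    and "length fs = n"
    using assms by (auto simp: represents_def)
  then have "openin (mtop Y) V" "y \<in> V" "tuple_class V fs \<in> tuple_presheaf Y X (cform Y) n V"
    by (auto simp: local_cor_def intro: tuple_class_in_presheaf)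
  from germ_eqD[OF eq this] obtain W where W: "openin (mtop Y) W" "y \<in> W" "W \<subseteq> V \<inter> V'"
    "restrict (tuple_class V fs) W = restrict (tuple_class V' fs') W"
    by blast
  then have tc: "tuple_class W fs = tuple_class W fs'"
    by (simp add: restrict_tuple_class)
  have "mset (map (\<lambda>f. f z) fs') = mset (map (\<lambda>f. f z) fs)" if "z \<in> W" for z
    using that fun_cong[OF tc, of z] by (simp add: tuple_class_def)
  then show ?thesis using local_step_refl[OF loc W(1-3)] by simp
qed

lemma cor_step_represents:
  assumes "cor_step Y X U a b" "y \<in> U"
  obtains p q where "represents Y X y a p" "represents Y X y b q" "local_step Y X y p q"
  using assms(1)
proof cases
  case (1 F n G m H)
  obtain V fs gs where V: "openin (mtop Y) V" "y \<in> V" "V \<subseteq> U"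
    and fs: "fs \<in> tuples Y X (cform Y) n V" and gs: "gs \<in> tuples Y X no_form m V"
    and eq: "F y = germ (mtop Y) (tuple_presheaf Y X (cform Y) n) res_fun y V (tuple_class V fs)"
      "H y = germ (mtop Y) (tuple_presheaf Y X (cform Y) (n + m)) res_fun y V
         (tuple_class V (fs @ gs))"
    using bspec[OF 1(6)[unfolded is_concat_def] assms(2)] by blast
  have fgs: "fs @ gs \<in> tuples Y X (cform Y) (n + m) V"
    using tuples_append[OF fs gs] by (simp add: no_form_def)
  note len = length_tuples[OF fs] length_tuples[OF gs]
  have loc: "local_cor Y X y (V, fs)" "local_cor Y X y (V, fs @ gs)"
    using V fs fgs len by (auto simp: local_cor_def)
  show ?thesis
  proof (rule that)
    show "represents Y X y a (V, fs)" "represents Y X y b (V, fs @ gs)"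
      using 1(1,2) loc eq len by (auto simp: represents_def)
    show "local_step Y X y (V, fs) (V, fs @ gs)"
      using loc V gs len unfolding local_step_def
      by (auto intro!: exI[of _ V] exI[of _ gs])
  qed
qed

text \<open>Consecutive links of the chain may present the section between them by different tuples;
  \<open>represents_unique\<close> bridges the gap by one more local step.\<close>

lemma equivclp_local_step:
  assumes "equivclp (cor_step Y X U) a b" "y \<in> U" "represents Y X y a p" "represents Y X y b q"
  shows "equivclp (local_step Y X y) p q"
  using assms(1,4)
proof (induction arbitrary: q rule: equivclp_induct)
  case base
  then show ?case using represents_unique[OF assms(3)] by blast
next
  case (step b c)
  from step.hyps(2) obtain r s where "represents Y X y b r" "represents Y X y c s"
    "equivclp (local_step Y X y) r s"
    using cor_step_represents[OF _ assms(2)] by (metis r_into_equivclp converse_r_into_equivclp)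
  then show ?case
    using step.IH represents_unique[OF _ step.prems] by (meson equivclp_trans r_into_equivclp)
qed

text \<open>Equal germs give equal classes over some open \<open>W\<close>, hence a chain of
  \<open>cor_step\<close>s over \<open>W\<close>. Read at \<open>y\<close>, this chain becomes one
  of local steps between tuples.\<close>

lemma tuple_germ_eqD:
  assumes "tuple_germ Y X y V fs = tuple_germ Y X y V' fs'"
    and loc: "local_cor Y X y (V, fs)" "local_cor Y X y (V', fs')"
  shows "equivclp (local_step Y X y) (V, fs) (V', fs')"
proof -
  obtain W where W: "openin (mtop Y) W" "y \<in> W" "W \<subseteq> V \<inter> V'"
    and eq: "quot_res Y X W (cor_rel Y X V `` {cor_of Y X V fs}) =
      quot_res Y X W (cor_rel Y X V' `` {cor_of Y X V' fs'})"
    using germ_eqD[OF assms(1)[unfolded tuple_germ_def] _ _ cor_of_in_quot_presheaf[OF loc(1)]] loc(1)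
    by (auto simp: local_cor_def)
  have "cor_rel Y X W `` {cor_of Y X W fs} = cor_rel Y X W `` {cor_of Y X W fs'}"
    using eq quot_res_cor_of[OF loc(1) W(1)] quot_res_cor_of[OF loc(2) W(1)] W(3) by simp
  then have "equivclp (cor_step Y X W) (cor_of Y X W fs) (cor_of Y X W fs')"
    unfolding cor_rel_def by (auto simp: set_eq_iff)
  \<comment> \<open>Passing to \<open>W\<close> does not change germs, so the original tuple on the
    larger set still presents the restricted section at \<open>y\<close>.\<close>
  moreover have "represents Y X y (cor_of Y X W fs) (V, fs)" if "local_cor Y X y (V, fs)" "W \<subseteq> V"
    for V fs
    using that W(1,2) germ_tuple_class_subset[of Y V W y fs X "cform Y" "length fs"]
    by (simp add: represents_def to_sheaf_def local_cor_def)
  ultimately show ?thesis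
    using equivclp_local_step[OF _ W(2)] W(3) loc by (meson le_inf_iff)
qed


lemma tuple_germ_equivclp:
  assumes "equivclp (local_step Y X y) p q"
  shows "tuple_germ Y X y (fst p) (snd p) = tuple_germ Y X y (fst q) (snd q)"
  using assms
proof (induction rule: equivclp_induct)
  case (step q r)
  then show ?case using tuple_germ_eqI[of Y X y "fst q" "snd q" "fst r" "snd r"]
      tuple_germ_eqI[of Y X y "fst r" "snd r" "fst q" "snd q"] by auto
qed simp

text \<open>Two layers of sheafification are unwound: near \<open>y\<close> the section is the class
  of some \<open>F\<close>, and \<open>F\<close> is given by one tuple only after shrinking once
  more to \<open>W\<close>. The same tuple serves all points of the neighbourhood, as gluing on the
  product requires.\<close>

lemma SCor_local:
  assumes s: "s \<in> SCor Y X" and y: "y \<in> topspace (mtop Y)"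
  shows "\<exists>V fs. local_cor Y X y (V, fs) \<and> (\<forall>z\<in>V. s z = tuple_germ Y X z V fs)"
proof -
  have "\<exists>V C. openin (mtop Y) V \<and> y \<in> V \<and> V \<subseteq> topspace (mtop Y) \<and> C \<in> quot_presheaf Y X V \<and>
      (\<forall>z\<in>V. s z = germ (mtop Y) (quot_presheaf Y X) (quot_res Y X) z V C)"
    using assms by (simp add: SCor_def sheafify_def)
  then obtain V C where V: "openin (mtop Y) V" "y \<in> V" and C: "C \<in> quot_presheaf Y X V"
    and sV: "\<forall>z\<in>V. s z = germ (mtop Y) (quot_presheaf Y X) (quot_res Y X) z V C"
    by blast
  from C obtain n F where F: "F \<in> SCor_n Y X n V" and Cn: "C = cor_rel Y X V `` {(n, F)}"
    unfolding quot_presheaf_def quotient_def cor_union_def by auto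
  obtain W fs where W: "openin (mtop Y) W" "y \<in> W" "W \<subseteq> V" and fs: "fs \<in> tuples Y X (cform Y) n W"
    and FW: "\<And>z. z \<in> W \<Longrightarrow>
      F z = germ (mtop Y) (tuple_presheaf Y X (cform Y) n) res_fun z W (tuple_class W fs)"
    by (rule Cor_n_local[OF F V(2)]) (rule that)
  note n = length_tuples[OF fs]
  have loc: "local_cor Y X z (W, fs)" if "z \<in> W" for z
    using W fs n that by (simp add: local_cor_def)
  have "cor_restrict W (n, F) = cor_of Y X W fs"
    unfolding cor_restrict_def to_sheaf_def prod.case n
    using FW by (intro arg_cong2[of _ _ _ _ Pair] restrict_ext) simp_all
  then have "quot_res Y X W C = cor_rel Y X W `` {cor_of Y X W fs}"
    unfolding Cn by (simp only: quot_res_class[OF W(1,3)])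
  \<comment> \<open>The class over \<open>W\<close> is written as its own restriction to
    \<open>W\<close>, since \<open>germ_eqI\<close> compares two restrictions.\<close>
  also have "\<dots> = quot_res Y X W (cor_rel Y X W `` {cor_of Y X W fs})"
    using quot_res_cor_of[OF loc[OF W(2)] W(1)] by simp
  finally have res: "quot_res Y X W C = quot_res Y X W (cor_rel Y X W `` {cor_of Y X W fs})" .
  have "s z = tuple_germ Y X z W fs" if z: "z \<in> W" for z
  proof -
    have "s z = germ (mtop Y) (quot_presheaf Y X) (quot_res Y X) z V C" using sV W(3) z by blast
    also have "\<dots> = tuple_germ Y X z W fs"
      unfolding tuple_germ_def
      by (rule germ_eqI[OF functorial_quot_res V(1) C W(1)
            cor_of_in_quot_presheaf[OF loc[OF z]] W(1) z _ res]) (use W(3) in blast)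
    finally show ?thesis .
  qed
  then show ?thesis using loc[OF W(2)] by blast
qed

lemma SCorI:
  assumes "s \<in> extensional (topspace (mtop Y))"
    and loc: "\<And>y. y \<in> topspace (mtop Y) \<Longrightarrow>
      \<exists>V fs. local_cor Y X y (V, fs) \<and> (\<forall>z\<in>V. s z = tuple_germ Y X z V fs)"
  shows "s \<in> SCor Y X"
  unfolding SCor_def sheafify_def
proof (intro CollectI conjI ballI assms(1))
  fix y assume "y \<in> topspace (mtop Y)"
  from loc[OF this] obtain V fs where V: "local_cor Y X y (V, fs)"
    and s: "\<forall>z\<in>V. s z = tuple_germ Y X z V fs"
    by blast
  have "openin (mtop Y) V" "y \<in> V" using V by (simp_all add: local_cor_def)
  then show "\<exists>V C. openin (mtop Y) V \<and> y \<in> V \<and> V \<subseteq> topspace (mtop Y) \<and> C \<in> quot_presheaf Y X V \<and>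
      (\<forall>z\<in>V. s z = germ (mtop Y) (quot_presheaf Y X) (quot_res Y X) z V C)"
    using s[unfolded tuple_germ_def] cor_of_in_quot_presheaf[OF V] openin_subset by blast
qed


section \<open>The external sum of correspondences\<close>

lemma tuples_no_form_comp:
  assumes "chart_affine Y Y' h \<sigma> L c" "charted X" "openin (mtop Y') V" "fs \<in> tuples Y' X no_form n V"
  shows "map (\<lambda>f. f \<circ> h) fs \<in> tuples Y X no_form n (preim Y h V)"
  by (rule tuples_chart_affine_comp[OF assms]) (simp add: no_form_def)

lemma local_cor_comp:
  assumes h: "chart_affine Y Y' h \<sigma> L c" and X: "charted X"
    and \<eta>: "\<And>i y v w. i \<in> cidx Y \<Longrightarrow> y \<in> cdom Y i \<Longrightarrow>
      cform Y' (\<sigma> i) (cmap Y' (\<sigma> i) (h y)) (L v) (L w) = cform Y i (cmap Y i y) v w"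
    and y: "y \<in> topspace (mtop Y)" and loc: "local_cor Y' X (h y) (V, fs)"
  shows "local_cor Y X y (preim Y h V, map (\<lambda>f. f \<circ> h) fs)"
proof -
  have V: "openin (mtop Y') V" "h y \<in> V" "fs \<in> tuples Y' X (cform Y') (length fs) V"
    using loc by (simp_all add: local_cor_def)
  have "map (\<lambda>f. f \<circ> h) fs \<in> tuples Y X (cform Y) (length fs) (preim Y h V)"
    by (rule tuples_chart_affine_comp[OF h X V(1,3) \<eta>])
  then show ?thesis
    using openin_preim[OF h V(1)] V(2) y by (simp add: local_cor_def preim_def)
qed

text \<open>The isotropic tuple witnessing the step is composed with \<open>h\<close> and stays
  isotropic. This makes \<open>cor_comp\<close> independent of the tuple that presents
  \<open>H\<close>.\<close>

lemma local_step_comp: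
  assumes h: "chart_affine Y Y' h \<sigma> L c" and X: "charted X"
    and \<eta>: "\<And>i y v w. i \<in> cidx Y \<Longrightarrow> y \<in> cdom Y i \<Longrightarrow>
      cform Y' (\<sigma> i) (cmap Y' (\<sigma> i) (h y)) (L v) (L w) = cform Y i (cmap Y i y) v w"
    and y: "y \<in> topspace (mtop Y)" and st: "local_step Y' X (h y) (V, fs) (V', fs')"
  shows "local_step Y X y (preim Y h V, map (\<lambda>f. f \<circ> h) fs) (preim Y h V', map (\<lambda>f. f \<circ> h) fs')"
proof -
  obtain W gs where W: "openin (mtop Y') W" "h y \<in> W" "W \<subseteq> V \<inter> V'"
    and gs: "gs \<in> tuples Y' X no_form (length gs) W"
    and eq: "\<forall>z\<in>W. mset (map (\<lambda>f. f z) fs') = mset (map (\<lambda>f. f z) (fs @ gs))"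
    and loc: "local_cor Y' X (h y) (V, fs)" "local_cor Y' X (h y) (V', fs')"
    using st unfolding local_step_def by auto
  have "y \<in> preim Y h W" "preim Y h W \<subseteq> preim Y h V \<inter> preim Y h V'"
    using W y by (auto simp: preim_def)
  moreover have "\<forall>z\<in>preim Y h W. mset (map (\<lambda>f. f z) (map (\<lambda>f. f \<circ> h) fs')) =
      mset (map (\<lambda>f. f z) (map (\<lambda>f. f \<circ> h) fs @ map (\<lambda>f. f \<circ> h) gs))"
    using eq by (simp add: preim_def o_def del: mset_map)
  ultimately show ?thesis
    using local_cor_comp[OF h X \<eta> y loc(1)] local_cor_comp[OF h X \<eta> y loc(2)]
      openin_preim[OF h W(1)] tuples_no_form_comp[OF h X W(1) gs]
    unfolding local_step_def prod.case length_map
    by (intro conjI exI[of _ "preim Y h W"] exI[of _ "map (\<lambda>f. f \<circ> h) gs"]) simp_all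
qed

section \<open>The external sum of tuples and of germs\<close>

definition prod_tuple :: "('a \<Rightarrow> 'x) list \<Rightarrow> ('m \<Rightarrow> 'x) list \<Rightarrow> ('a \<times> 'm \<Rightarrow> 'x) list" where
  "prod_tuple fs gs = map (\<lambda>f. f \<circ> fst) fs @ map (\<lambda>g. g \<circ> snd) gs"

lemma chart_affine_fst:
  "charted Y \<Longrightarrow> charted M \<Longrightarrow> chart_affine (prod_mfd Y M) Y fst fst fst 0"
  by (auto simp: chart_affine_def charted_prod_mfd continuous_map_fst bounded_linear_fst)

lemma chart_affine_snd:
  "charted Y \<Longrightarrow> charted M \<Longrightarrow> chart_affine (prod_mfd Y M) M snd snd snd 0"
  by (auto simp: chart_affine_def charted_prod_mfd continuous_map_snd bounded_linear_snd)

lemma chart_affine_slice: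
  assumes "charted Y" "charted M" "k \<in> cidx M" "p \<in> cdom M k"
  shows "chart_affine Y (prod_mfd Y M) (\<lambda>y. (y, p)) (\<lambda>i. (i, k)) (\<lambda>x. (x, 0)) (0, cmap M k p)"
proof -
  have "p \<in> topspace (mtop M)" using assms unfolding charted_def by blast
  then show ?thesis
    using assms
    by (auto simp: chart_affine_def charted_prod_mfd continuous_map_pairwise o_def
        intro!: bounded_linear_Pair bounded_linear_ident bounded_linear_zero)
qed

lemma chart_affine_const:
  assumes "charted Y" "charted M" "k \<in> cidx M" "p \<in> cdom M k"
  shows "chart_affine Y M (\<lambda>y. p) (\<lambda>i. k) (\<lambda>x. 0) (cmap M k p)"
proof -
  have "p \<in> topspace (mtop M)" using assms unfolding charted_def by blast
  then show ?thesis
    using assms by (auto simp: chart_affine_def bounded_linear_zero)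
qed

text \<open>The coordinate forms inserted below are the pullbacks of the factor forms along the two
  projections. The form of the product is by definition their sum, so concatenating the two pulled
  back tuples meets it exactly.\<close>

lemma local_cor_prod:
  assumes Y: "charted Y" and M: "charted M" and X: "charted X"
    and fs: "local_cor Y X y (V, fs)" and gs: "local_cor M X m (W, gs)"
  shows "local_cor (prod_mfd Y M) X (y, m) (V \<times> W, prod_tuple fs gs)"
proof -
  let ?P = "prod_mfd Y M"
  have V: "openin (mtop Y) V" "y \<in> V" "fs \<in> tuples Y X (cform Y) (length fs) V"
    and W: "openin (mtop M) W" "m \<in> W" "gs \<in> tuples M X (cform M) (length gs) W"
    using fs gs by (simp_all add: local_cor_def)
  have sub: "V \<times> W \<subseteq> preim ?P fst V" "V \<times> W \<subseteq> preim ?P snd W"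
    using openin_subset[OF V(1)] openin_subset[OF W(1)] by (auto simp: preim_def)
  have "map (\<lambda>f. f \<circ> fst) fs \<in> tuples ?P X
      (\<lambda>i x v w. cform Y (fst i) (fst x) (fst v) (fst w)) (length fs) (preim ?P fst V)"
    by (rule tuples_chart_affine_comp[OF chart_affine_fst[OF Y M] X V(1,3)]) auto
  moreover have "map (\<lambda>f. f \<circ> snd) gs \<in> tuples ?P X
      (\<lambda>i x v w. cform M (snd i) (snd x) (snd v) (snd w)) (length gs) (preim ?P snd W)"
    by (rule tuples_chart_affine_comp[OF chart_affine_snd[OF Y M] X W(1,3)]) auto
  ultimately have "prod_tuple fs gs \<in> tuples ?P X (cform ?P) (length fs + length gs) (V \<times> W)"
    unfolding prod_tuple_def
    by (rule tuples_append[OF tuples_subset[OF _ sub(1)] tuples_subset[OF _ sub(2)]]) auto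
  then show ?thesis
    using V W by (simp add: local_cor_def openin_prod_Times_iff prod_tuple_def)
qed

lemma local_step_prod_left:
  assumes Y: "charted Y" and M: "charted M" and X: "charted X"
    and st: "local_step Y X y (V, fs) (V', fs')" and loc': "local_cor M X m (W, gs)"
  shows "local_step (prod_mfd Y M) X (y, m) (V \<times> W, prod_tuple fs gs) (V' \<times> W, prod_tuple fs' gs)"
proof -
  let ?P = "prod_mfd Y M"
  obtain U ks where U: "openin (mtop Y) U" "y \<in> U" "U \<subseteq> V \<inter> V'"
    and ks: "ks \<in> tuples Y X no_form (length ks) U"
    and eq: "\<forall>z\<in>U. mset (map (\<lambda>f. f z) fs') = mset (map (\<lambda>f. f z) (fs @ ks))"
    and loc: "local_cor Y X y (V, fs)" "local_cor Y X y (V', fs')"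
    using st unfolding local_step_def by auto
  have W: "openin (mtop M) W" "m \<in> W" using loc' by (simp_all add: local_cor_def)
  have sub: "U \<times> W \<subseteq> preim ?P fst U"
    using openin_subset[OF U(1)] openin_subset[OF W(1)] by (auto simp: preim_def)
  have "map (\<lambda>f. f \<circ> fst) ks \<in> tuples ?P X no_form (length ks) (U \<times> W)"
    by (rule tuples_subset[OF tuples_no_form_comp[OF chart_affine_fst[OF Y M] X U(1) ks] sub])
  \<comment> \<open>The isotropic maps sit beside \<open>fs\<close> on the left and at the very end
    on the right; multisets do not see the order.\<close>
  moreover have "mset (map (\<lambda>f. f z) (prod_tuple fs' gs)) =
      mset (map (\<lambda>f. f z) (prod_tuple fs gs @ map (\<lambda>f. f \<circ> fst) ks))" if "z \<in> U \<times> W" for z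
    using bspec[OF eq, of "fst z"] that
    by (auto simp: prod_tuple_def o_def simp del: mset_map)
  moreover have "openin (mtop ?P) (U \<times> W)" "(y, m) \<in> U \<times> W" "U \<times> W \<subseteq> (V \<times> W) \<inter> (V' \<times> W)"
    using U W by (auto simp: openin_prod_Times_iff)
  ultimately show ?thesis
    using local_cor_prod[OF Y M X loc(1) loc'] local_cor_prod[OF Y M X loc(2) loc']
    unfolding local_step_def prod.case
    by (intro conjI exI[of _ "U \<times> W"] exI[of _ "map (\<lambda>f. f \<circ> fst) ks"] ballI) simp_all
qed

lemma local_step_prod_right:
  assumes Y: "charted Y" and M: "charted M" and X: "charted X"
    and loc': "local_cor Y X y (V, fs)" and st: "local_step M X m (W, gs) (W', gs')"
  shows "local_step (prod_mfd Y M) X (y, m) (V \<times> W, prod_tuple fs gs) (V \<times> W', prod_tuple fs gs')"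
proof -
  let ?P = "prod_mfd Y M"
  obtain U ks where U: "openin (mtop M) U" "m \<in> U" "U \<subseteq> W \<inter> W'"
    and ks: "ks \<in> tuples M X no_form (length ks) U"
    and eq: "\<forall>z\<in>U. mset (map (\<lambda>f. f z) gs') = mset (map (\<lambda>f. f z) (gs @ ks))"
    and loc: "local_cor M X m (W, gs)" "local_cor M X m (W', gs')"
    using st unfolding local_step_def by auto
  have V: "openin (mtop Y) V" "y \<in> V" using loc' by (simp_all add: local_cor_def)
  have sub: "V \<times> U \<subseteq> preim ?P snd U"
    using openin_subset[OF U(1)] openin_subset[OF V(1)] by (auto simp: preim_def)
  have "map (\<lambda>f. f \<circ> snd) ks \<in> tuples ?P X no_form (length ks) (V \<times> U)"
    by (rule tuples_subset[OF tuples_no_form_comp[OF chart_affine_snd[OF Y M] X U(1) ks] sub])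
  moreover have "mset (map (\<lambda>f. f z) (prod_tuple fs gs')) =
      mset (map (\<lambda>f. f z) (prod_tuple fs gs @ map (\<lambda>f. f \<circ> snd) ks))" if "z \<in> V \<times> U" for z
    using bspec[OF eq, of "snd z"] that
    by (auto simp: prod_tuple_def o_def simp del: mset_map)
  moreover have "openin (mtop ?P) (V \<times> U)" "(y, m) \<in> V \<times> U" "V \<times> U \<subseteq> (V \<times> W) \<inter> (V \<times> W')"
    using U V by (auto simp: openin_prod_Times_iff)
  ultimately show ?thesis
    using local_cor_prod[OF Y M X loc' loc(1)] local_cor_prod[OF Y M X loc' loc(2)]
    unfolding local_step_def prod.case
    by (intro conjI exI[of _ "V \<times> U"] exI[of _ "map (\<lambda>f. f \<circ> snd) ks"] ballI) simp_all
qed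

text \<open>One factor moves at a time: the chain on \<open>Y\<close> runs with
  \<open>(W, gs)\<close> fixed, then the chain on \<open>M\<close> runs with
  \<open>(V', fs')\<close> fixed.\<close>

lemma tuple_germ_prod_cong:
  assumes Y: "charted Y" and M: "charted M" and X: "charted X"
    and V: "local_cor Y X y (V, fs)" "local_cor Y X y (V', fs')"
      "tuple_germ Y X y V fs = tuple_germ Y X y V' fs'"
    and W: "local_cor M X m (W, gs)" "local_cor M X m (W', gs')"
      "tuple_germ M X m W gs = tuple_germ M X m W' gs'"
  shows "tuple_germ (prod_mfd Y M) X (y, m) (V \<times> W) (prod_tuple fs gs) =
    tuple_germ (prod_mfd Y M) X (y, m) (V' \<times> W') (prod_tuple fs' gs')"
proof -
  let ?R = "equivclp (local_step (prod_mfd Y M) X (y, m))"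
  have "?R ((\<lambda>(V, fs). (V \<times> W, prod_tuple fs gs)) (V, fs))
      ((\<lambda>(V, fs). (V \<times> W, prod_tuple fs gs)) (V', fs'))"
    using tuple_germ_eqD[OF V(3,1,2)]
    by (rule equivclp_map) (use local_step_prod_left[OF Y M X _ W(1)] in auto)
  moreover have "?R ((\<lambda>(W, gs). (V' \<times> W, prod_tuple fs' gs)) (W, gs))
      ((\<lambda>(W, gs). (V' \<times> W, prod_tuple fs' gs)) (W', gs'))"
    using tuple_germ_eqD[OF W(3,1,2)]
    by (rule equivclp_map) (use local_step_prod_right[OF Y M X V(2)] in auto)
  ultimately have "?R (V \<times> W, prod_tuple fs gs) (V' \<times> W', prod_tuple fs' gs')"
    by (auto intro: equivclp_trans)
  from tuple_germ_equivclp[OF this] show ?thesis by simp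
qed

lemma exists_prod_cor:
  assumes Y: "charted Y" and M: "charted M" and X: "charted X"
    and s: "s \<in> SCor Y X" and I: "I \<in> SCor M X"
  obtains H where "H \<in> SCor (prod_mfd Y M) X"
    "\<And>y m. y \<in> topspace (mtop Y) \<Longrightarrow> m \<in> topspace (mtop M) \<Longrightarrow>
      \<exists>V fs W gs. local_cor Y X y (V, fs) \<and> local_cor M X m (W, gs) \<and> s y = tuple_germ Y X y V fs \<and>
        H (y, m) = tuple_germ (prod_mfd Y M) X (y, m) (V \<times> W) (prod_tuple fs gs)"
proof -
  let ?P = "prod_mfd Y M"
  have "\<forall>y. \<exists>V fs. y \<in> topspace (mtop Y) \<longrightarrow>
      local_cor Y X y (V, fs) \<and> (\<forall>z\<in>V. s z = tuple_germ Y X z V fs)"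
    using SCor_local[OF s] by blast
  then obtain V fs where V: "\<And>y. y \<in> topspace (mtop Y) \<Longrightarrow> local_cor Y X y (V y, fs y)"
    and sV: "\<And>y z. y \<in> topspace (mtop Y) \<Longrightarrow> z \<in> V y \<Longrightarrow> s z = tuple_germ Y X z (V y) (fs y)"
    by metis
  have "\<forall>m. \<exists>W gs. m \<in> topspace (mtop M) \<longrightarrow>
      local_cor M X m (W, gs) \<and> (\<forall>z\<in>W. I z = tuple_germ M X z W gs)"
    using SCor_local[OF I] by blast
  then obtain W gs where W: "\<And>m. m \<in> topspace (mtop M) \<Longrightarrow> local_cor M X m (W m, gs m)"
    and IW: "\<And>m z. m \<in> topspace (mtop M) \<Longrightarrow> z \<in> W m \<Longrightarrow> I z = tuple_germ M X z (W m) (gs m)"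
    by metis
  define H where "H = (\<lambda>(y, m)\<in>topspace (mtop Y) \<times> topspace (mtop M).
      tuple_germ ?P X (y, m) (V y \<times> W m) (prod_tuple (fs y) (gs m)))"
  \<comment> \<open>Tuples were chosen independently at every point, and \<open>H\<close> at
    \<open>(y', m')\<close> is defined by those chosen at \<open>y'\<close> and \<open>m'\<close>.
    The tuples chosen at \<open>y\<close> and \<open>m\<close> present the same germs of
    \<open>s\<close> and \<open>I\<close> there, so they give the same value; this is the gluing
    condition.\<close>
  have H: "H (y', m') = tuple_germ ?P X (y', m') (V y \<times> W m) (prod_tuple (fs y) (gs m))"
    if y: "y \<in> topspace (mtop Y)" and m: "m \<in> topspace (mtop M)" and y': "y' \<in> V y" and m': "m' \<in> W m"
    for y m y' m'
  proof -
    have top: "y' \<in> topspace (mtop Y)" "m' \<in> topspace (mtop M)"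
      using V[OF y] W[OF m] y' m' openin_subset by (fastforce simp: local_cor_def)+
    have "y' \<in> V y'" "m' \<in> W m'"
      using V[OF top(1)] W[OF top(2)] by (simp_all add: local_cor_def)
    then have "tuple_germ Y X y' (V y') (fs y') = tuple_germ Y X y' (V y) (fs y)"
      "tuple_germ M X m' (W m') (gs m') = tuple_germ M X m' (W m) (gs m)"
      using sV[OF top(1)] sV[OF y y'] IW[OF top(2)] IW[OF m m'] by simp_all
    moreover have "local_cor Y X y' (V y, fs y)" "local_cor M X m' (W m, gs m)"
      using V[OF y] W[OF m] y' m' by (simp_all add: local_cor_def)
    ultimately show ?thesis
      using tuple_germ_prod_cong[OF Y M X V[OF top(1)] _ _ W[OF top(2)]] top
      by (simp add: H_def)
  qed
  have "H \<in> SCor ?P X"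
  proof (rule SCorI)
    show "H \<in> extensional (topspace (mtop ?P))" by (simp add: H_def)
    fix q assume "q \<in> topspace (mtop ?P)"
    then obtain y m where q: "q = (y, m)" and ym: "y \<in> topspace (mtop Y)" "m \<in> topspace (mtop M)"
      by auto
    show "\<exists>U hs. local_cor ?P X q (U, hs) \<and> (\<forall>z\<in>U. H z = tuple_germ ?P X z U hs)"
      using local_cor_prod[OF Y M X V[OF ym(1)] W[OF ym(2)]] H[OF ym] unfolding q
      by (intro exI[of _ "V y \<times> W m"] exI[of _ "prod_tuple (fs y) (gs m)"]) auto
  qed
  moreover have "y \<in> V y" "s y = tuple_germ Y X y (V y) (fs y)" if "y \<in> topspace (mtop Y)" for y
    using V[OF that] sV[OF that] by (simp_all add: local_cor_def)
  moreover have "m \<in> W m" if "m \<in> topspace (mtop M)" for m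
    using W[OF that] by (simp add: local_cor_def)
  ultimately show ?thesis
    using that[of H] V W H by blast
qed

text \<open>Vectors tangent to a slice have \<open>M\<close>-component 0 and constant maps have
  derivative 0; both lead to this value of the form.\<close>

lemma cform_zero:
  assumes "two_form M" "k \<in> cidx M" "p \<in> cdom M k"
  shows "cform M k (cmap M k p) 0 0 = 0"
  using assms by (auto simp: two_form_def)

text \<open>
  Over a slice the second summand of the external sum consists of constant maps, which are
  isotropic and hence invisible in \<open>SCor\<close>.
\<close>

lemma cor_comp_prod_cor:
  assumes Y: "charted Y" and M: "charted M" and X: "charted X" and \<omega>: "two_form M"
    and s: "s \<in> SCor Y X" and p: "p \<in> topspace (mtop M)"
    and H: "\<And>y. y \<in> topspace (mtop Y) \<Longrightarrow>
      \<exists>V fs W gs. local_cor Y X y (V, fs) \<and> local_cor M X p (W, gs) \<and> s y = tuple_germ Y X y V fs \<and>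
        H (y, p) = tuple_germ (prod_mfd Y M) X (y, p) (V \<times> W) (prod_tuple fs gs)"
  shows "cor_comp Y (prod_mfd Y M) X H (\<lambda>y. (y, p)) = s"
proof
  fix y
  let ?P = "prod_mfd Y M" and ?h = "\<lambda>y. (y, p)"
  obtain k where k: "k \<in> cidx M" "p \<in> cdom M k" using M p unfolding charted_def by blast
  note h = chart_affine_slice[OF Y M k]
  have \<eta>: "cform ?P (i, k) (cmap ?P (i, k) (y, p)) (v, 0) (w, 0) = cform Y i (cmap Y i y) v w"
    for i y v w
    using cform_zero[OF \<omega> k] by simp
  show "cor_comp Y ?P X H ?h y = s y"
  proof (cases "y \<in> topspace (mtop Y)")
    \<comment> \<open>Outside the manifold both sides are extensional functions at their default
      value.\<close>
    case False
    then show ?thesis using s by (simp add: cor_comp_def SCor_def sheafify_def extensional_def)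
  next
    case y: True
    obtain V fs W gs where V: "local_cor Y X y (V, fs)" and W: "local_cor M X p (W, gs)"
      and sy: "s y = tuple_germ Y X y V fs"
      and Hy: "H (y, p) = tuple_germ ?P X (y, p) (V \<times> W) (prod_tuple fs gs)"
      using H[OF y] by blast
    note VW = local_cor_prod[OF Y M X V W]
    have opV: "openin (mtop Y) V" "y \<in> V" and opW: "openin (mtop M) W" "p \<in> W"
      and gs: "gs \<in> tuples M X (cform M) (length gs) W"
      using V W by (simp_all add: local_cor_def)
    \<comment> \<open>Although \<open>gs\<close> is symplectic on \<open>M\<close>, its composite
      with the constant map to \<open>p\<close> pulls every form back along the zero map and so is
      isotropic.\<close>
    have "map (\<lambda>g. g \<circ> (\<lambda>y. p)) gs \<in> tuples Y X no_form (length gs) (preim Y (\<lambda>y. p) W)"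
      by (rule tuples_chart_affine_comp[OF chart_affine_const[OF Y M k] X opW(1) gs])
        (simp add: no_form_def cform_zero[OF \<omega> k])
    then have const: "map (\<lambda>g. g \<circ> (\<lambda>y. p)) gs \<in> tuples Y X no_form (length gs) V"
      by (rule tuples_subset) (use openin_subset[OF opV(1)] opW(2) in \<open>auto simp: preim_def\<close>)
    \<comment> \<open>Since \<open>p\<close> lies in \<open>W\<close>, the slice over
      \<open>V\<close> stays inside \<open>V \<times> W\<close>, and there the product tuple is
      \<open>fs\<close> followed by constants: one local step away from \<open>fs\<close>.\<close>
    have "local_step Y X y (V, fs) (preim Y ?h (V \<times> W), map (\<lambda>f. f \<circ> ?h) (prod_tuple fs gs))"
      unfolding local_step_def prod.case
      using V local_cor_comp[OF h X \<eta> y VW] opV const openin_subset[OF opV(1)] opW(2)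
      by (intro conjI exI[of _ V] exI[of _ "map (\<lambda>g. g \<circ> (\<lambda>y. p)) gs"])
        (auto simp: preim_def prod_tuple_def o_def)
    then have eq: "tuple_germ Y X y (preim Y ?h (V \<times> W)) (map (\<lambda>f. f \<circ> ?h) (prod_tuple fs gs)) = s y"
      using tuple_germ_eqI sy by metis
    \<comment> \<open>This justifies the definite description in \<open>cor_comp\<close>: another
      tuple presenting \<open>H\<close> at \<open>(y, p)\<close> is joined to the product tuple by a
      chain on the product, and the chain is pulled back to the slice step by step.\<close>
    have uniq: "tuple_germ Y X y (preim Y ?h U) (map (\<lambda>f. f \<circ> ?h) hs) = s y"
      if U: "local_cor ?P X (y, p) (U, hs)" and HU: "H (y, p) = tuple_germ ?P X (y, p) U hs" for U hs
    proof -
      let ?\<phi> = "\<lambda>(U, hs). (preim Y ?h U, map (\<lambda>f. f \<circ> ?h) hs)"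
      have "equivclp (local_step Y X y) (?\<phi> (V \<times> W, prod_tuple fs gs)) (?\<phi> (U, hs))"
        using tuple_germ_eqD[OF Hy[symmetric, unfolded HU] VW U]
        by (rule equivclp_map)
          (use local_step_comp[OF h X \<eta> y] in \<open>simp only: split_paired_all prod.case r_into_equivclp\<close>)
      from tuple_germ_equivclp[OF this] eq show ?thesis by simp
    qed
    have loc_iff: "local_cor ?P X (y, p) (U, hs) \<longleftrightarrow> openin (mtop ?P) U \<and> ?h y \<in> U \<and>
        hs \<in> tuples ?P X (cform ?P) (length hs) U" for U hs
      by (simp add: local_cor_def)
    show ?thesis
      unfolding cor_comp_def restrict_apply'[OF y]
    proof (rule the_equality)
      show "\<exists>U n hs. openin (mtop ?P) U \<and> ?h y \<in> U \<and> hs \<in> tuples ?P X (cform ?P) n U \<and>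
          H (?h y) = tuple_germ ?P X (?h y) U hs \<and>
          s y = tuple_germ Y X y {z \<in> topspace (mtop Y). ?h z \<in> U} (map (\<lambda>f. f \<circ> ?h) hs)"
        using VW[unfolded loc_iff] Hy eq[symmetric] unfolding preim_def by blast
      fix g assume "\<exists>U n hs. openin (mtop ?P) U \<and> ?h y \<in> U \<and> hs \<in> tuples ?P X (cform ?P) n U \<and>
          H (?h y) = tuple_germ ?P X (?h y) U hs \<and>
          g = tuple_germ Y X y {z \<in> topspace (mtop Y). ?h z \<in> U} (map (\<lambda>f. f \<circ> ?h) hs)"
      then obtain U n hs where U: "openin (mtop ?P) U" "?h y \<in> U" and hs: "hs \<in> tuples ?P X (cform ?P) n U"
        and HU: "H (?h y) = tuple_germ ?P X (?h y) U hs"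
        and g: "g = tuple_germ Y X y (preim Y ?h U) (map (\<lambda>f. f \<circ> ?h) hs)"
        unfolding preim_def by blast
      have "local_cor ?P X (y, p) (U, hs)"
        using U hs length_tuples[OF hs] by (simp add: local_cor_def)
      then show "g = s y" using uniq[OF _ HU] g by simp
    qed
  qed
qed


section \<open>Homotopies\<close>

text \<open>One \<open>H\<close> must serve every slice, as both ends of the homotopy have to equal
  \<open>F\<close>. On a generator it is the external sum with \<open>I\<close>; composition with a
  slice is additive, so differences reach all of the free group.\<close>

lemma exists_constant_homotopy:
  assumes "charted Y" "charted M" "charted X" "two_form M" "I \<in> SCor M X"
    and F: "F \<in> carrier (SC Y X)"
  obtains H where "H \<in> carrier (SC (prod_mfd Y M) X)"
    "\<And>p. p \<in> topspace (mtop M) \<Longrightarrow> SC_comp Y (prod_mfd Y M) X H (\<lambda>y. (y, p)) = F"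
proof -
  have "\<exists>K. K \<in> SCor (prod_mfd Y M) X \<and>
      (\<forall>p\<in>topspace (mtop M). cor_comp Y (prod_mfd Y M) X K (\<lambda>y. (y, p)) = s)"
    if s: "s \<in> SCor Y X" for s
  proof -
    obtain K where K: "K \<in> SCor (prod_mfd Y M) X" "\<And>y m. y \<in> topspace (mtop Y) \<Longrightarrow> m \<in> topspace (mtop M) \<Longrightarrow>
      \<exists>V fs W gs. local_cor Y X y (V, fs) \<and> local_cor M X m (W, gs) \<and> s y = tuple_germ Y X y V fs \<and>
        K (y, m) = tuple_germ (prod_mfd Y M) X (y, m) (V \<times> W) (prod_tuple fs gs)"
      by (rule exists_prod_cor[OF assms(1-3) s assms(5)]) (rule that)
    have "cor_comp Y (prod_mfd Y M) X K (\<lambda>y. (y, p)) = s" if p: "p \<in> topspace (mtop M)" for p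
      by (rule cor_comp_prod_cor[OF assms(1-4) s p K(2)[OF _ p]])
    then show ?thesis using K(1) by blast
  qed
  then obtain K where K: "\<And>s. s \<in> SCor Y X \<Longrightarrow> K s \<in> SCor (prod_mfd Y M) X"
    "\<And>s p. s \<in> SCor Y X \<Longrightarrow> p \<in> topspace (mtop M) \<Longrightarrow>
       cor_comp Y (prod_mfd Y M) X (K s) (\<lambda>y. (y, p)) = s"
    by metis
  have "Poly_Mapping.keys F \<subseteq> SCor Y X" using F by simp
  then have "\<exists>H. Poly_Mapping.keys H \<subseteq> SCor (prod_mfd Y M) X \<and>
      (\<forall>p\<in>topspace (mtop M). SC_comp Y (prod_mfd Y M) X H (\<lambda>y. (y, p)) = F)"
  proof (induction F rule: frag_induction)
    case zero
    show ?case by (intro exI[of _ 0]) (simp add: SC_comp_def)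
  next
    case (one s)
    then show ?case using K by (intro exI[of _ "frag_of (K s)"]) (simp add: SC_comp_def)
  next
    case (diff a b)
    then obtain Ha Hb where
      "Poly_Mapping.keys Ha \<subseteq> SCor (prod_mfd Y M) X" "Poly_Mapping.keys Hb \<subseteq> SCor (prod_mfd Y M) X"
      "\<forall>p\<in>topspace (mtop M). SC_comp Y (prod_mfd Y M) X Ha (\<lambda>y. (y, p)) = a"
      "\<forall>p\<in>topspace (mtop M). SC_comp Y (prod_mfd Y M) X Hb (\<lambda>y. (y, p)) = b"
      by blast
    then show ?case
      using keys_diff[of Ha Hb] by (intro exI[of _ "Ha - Hb"]) (auto simp: SC_comp_def frag_extend_diff)
  qed
  then show ?thesis using that by auto
qed

theorem lemma9p2:
  fixes X :: "('j, 'x, 'f::real_normed_vector) mfd"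
    and Y :: "('i, 'a, 'e::real_normed_vector) mfd"
    and M :: "('k, 'm, 'g::real_normed_vector) mfd"
    and p0 p1 :: 'm
  assumes "symplectic_manifold X" and "symplectic_manifold Y" and "symplectic_manifold M"
    and "connected_space (mtop M)"
    and "p0 \<in> topspace (mtop M)" and "p1 \<in> topspace (mtop M)"
    and "\<exists>I. I \<in> SCor M X"
  shows "equiv (carrier (SC Y X))
    {(F, G). F \<in> carrier (SC Y X) \<and> G \<in> carrier (SC Y X) \<and> M_homotopic Y X M p0 p1 F G}"
proof -
  let ?P = "prod_mfd Y M"
  let ?at = "\<lambda>p H. SC_comp Y ?P X H (\<lambda>y. (y, p))"
  have ch: "charted Y" "charted M" "charted X" and \<omega>: "two_form M"
    using assms(1-3) charted_smooth_manifold by (auto simp: symplectic_manifold_def)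
  obtain I where I: "I \<in> SCor M X" using assms(7) by blast
  have const: "\<exists>H\<in>carrier (SC ?P X). ?at p0 H = F \<and> ?at p1 H = F" if "F \<in> carrier (SC Y X)" for F
    using exists_constant_homotopy[OF ch \<omega> I that] assms(5,6) by metis
  have lin: "?at p (A + B - C) = ?at p A + ?at p B - ?at p C" for p A B C
    by (simp add: SC_comp_def frag_extend_add frag_extend_diff)
  have carr: "A + B - C \<in> carrier (SC ?P X)"
    if "A \<in> carrier (SC ?P X)" "B \<in> carrier (SC ?P X)" "C \<in> carrier (SC ?P X)" for A B C
    using that keys_add[of A B] keys_diff[of "A + B" C]
    unfolding carrier_free_Abelian_group_iff by blast
  have refl: "M_homotopic Y X M p0 p1 F F" if "F \<in> carrier (SC Y X)" for F
    using const[OF that] unfolding M_homotopic_def by blast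
  have sym: "M_homotopic Y X M p0 p1 G F"
    if FG: "F \<in> carrier (SC Y X)" "G \<in> carrier (SC Y X)" "M_homotopic Y X M p0 p1 F G" for F G
  proof -
    obtain H where H: "H \<in> carrier (SC ?P X)" "?at p0 H = F" "?at p1 H = G"
      using FG(3) unfolding M_homotopic_def by blast
    obtain A where A: "A \<in> carrier (SC ?P X)" "?at p0 A = F" "?at p1 A = F" using const FG(1) by blast
    obtain B where B: "B \<in> carrier (SC ?P X)" "?at p0 B = G" "?at p1 B = G" using const FG(2) by blast
    \<comment> \<open>The ends of the combination are F + G - F = G at \<open>p0\<close> and F + G -
      G = F at \<open>p1\<close>.\<close>
    show ?thesis
      unfolding M_homotopic_def
      using carr[OF A(1) B(1) H(1)] lin A B H by (intro bexI[of _ "A + B - H"]) simp_all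
  qed
  have trans: "M_homotopic Y X M p0 p1 F K"
    if FGK: "G \<in> carrier (SC Y X)" "M_homotopic Y X M p0 p1 F G" "M_homotopic Y X M p0 p1 G K" for F G K
  proof -
    obtain H where H: "H \<in> carrier (SC ?P X)" "?at p0 H = F" "?at p1 H = G"
      using FGK(2) unfolding M_homotopic_def by blast
    obtain H' where H': "H' \<in> carrier (SC ?P X)" "?at p0 H' = G" "?at p1 H' = K"
      using FGK(3) unfolding M_homotopic_def by blast
    obtain B where B: "B \<in> carrier (SC ?P X)" "?at p0 B = G" "?at p1 B = G" using const FGK(1) by blast
    \<comment> \<open>Subtracting the constant homotopy at \<open>G\<close> cancels the surplus
      \<open>G\<close> at both ends: F + G - G at \<open>p0\<close> and G + K - G at
      \<open>p1\<close>.\<close>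
    show ?thesis
      unfolding M_homotopic_def
      using carr[OF H(1) H'(1) B(1)] lin H H' B by (intro bexI[of _ "H + H' - B"]) simp_all
  qed
  show ?thesis
  proof (rule equivI)
    show "refl_on (carrier (SC Y X))
        {(F, G). F \<in> carrier (SC Y X) \<and> G \<in> carrier (SC Y X) \<and> M_homotopic Y X M p0 p1 F G}"
      using refl by (auto simp: refl_on_def)
  qed (use sym trans in \<open>blast intro: symI transI\<close>)+
qed

end
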